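(* Let $(X_t)_{t\geqslant 0}$ be a time-homogeneous, right-continuous, progressively measurable Markov process on a Polish space $(E,\mathscr{E})$ with extended generator $(L,D_w(L))$. Assume that $(X_t)_{t\geqslant 0}$ is non-explosive and ergodic, with invariant probability measure $\pi$. Let $\{E_n\}_{n=1}^{\infty}\subset\mathscr{E}$ be a sequence of bounded open sets with $E_n\uparrow E$ and $\bigcup_n E_n=E$, and let $H\subset E_1$ be a closed set with $\pi(H)>0$. Suppose that there exist non-negative norm-like functions $u,v\in D_w(L)$ such that: (a) $Lu(x)\geqslant -1$ for all $x\notin H$, and $u$ is locally bounded; (b) there exists a constant $d>0$ such that $Lv(x)\leqslant d\,\mathbf{1}_H(x)$ for all $x\in E$; (c) $\lim_{n\to\infty}\sup_{x\notin E_n}\dfrac{u(x)}{v(x)}=0$. Then $(X_t)_{t\geqslant 0}$ is not strongly ergodic.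
   Context: The process $(X_t)_{t\geqslant0}$ has transition function $P_t(x,\cdot)$ and lives on a probability space with natural filtration $(\mathscr{F}_t)_{t\geqslant0}$; $\mathbb{P}_x,\mathbb{E}_x$ denote law and expectation for the process started at $x$. For $A\in\mathscr{E}$ the hitting time $\tau_A:=\inf\{t\geqslant0: X_t\in A\}$ is a stopping time. Invariant measure: a $\sigma$-finite measure $\pi$ with $\pi(A)=\int_E P_t(x,A)\,\pi(\mathrm{d}x)$ for all $t>0$, $A\in\mathscr{E}$. Ergodic: there is a unique invariant probability measure $\pi$ such that $\lim_{t\to\infty}\|P_t(x,\cdot)-\pi\|_{\mathrm{Var}}=0$ for all $x\in E$, where $\|\cdot\|_{\mathrm{Var}}$ is the total variation distance. Strongly ergodic (uniformly ergodic): there exist $\varepsilon>0$, $C>0$ and an invariant probability measure $\pi$ such that $\sup_{x\in E}\|P_t(x,\cdot)-\pi\|_{\mathrm{Var}}\leqslant C e^{-\varepsilon t}$ for all $t\geqslant 0$. Extended generator: $D_w(L)$ is the set of measurable functions $f:E\to\mathbb{R}$ for which there is a measurable function $Lf$ such that $f(X_t)-f(X_0)-\int_0^t Lf(X_s)\,\mathrm{d}s$ is a local martingale (under every $\mathbb{P}_x$). Norm-like function: a measurable $f:E\to\mathbb{R}_+$ with $f(x)\to\infty$ as $x\to\infty$, meaning that the level sets $\{x: f(x)\leqslant r\}$ are precompact for each $r>0$.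
   Formalization: "u locally bounded" is taken as u bounded on every bounded set of the chosen complete metric (with mere pointwise local boundedness and metric-bounded E_n the claim fails); in (c) the supremum over an empty set is −∞, so E_n ≠ E for large n, which excludes compact E. *)

theory Defs
  imports "HOL-Probability.Probability"
begin

section \<open>Continuous-time martingales\<close>

text \<open>Time is \<^typ>\<open>real\<close>, restricted to \<open>t \<ge> 0\<close> throughout. The natural filtration is the raw one
  (neither completed nor made right-continuous); at negative times it is trivial.\<close>

definition natural_filtration ::
  "'w measure \<Rightarrow> (real \<Rightarrow> 'w \<Rightarrow> 'a::topological_space) \<Rightarrow> real \<Rightarrow> 'w measure" where
  "natural_filtration M X t =
     sigma (space M) {X s -` A \<inter> space M | s A. 0 \<le> s \<and> s \<le> t \<and> A \<in> sets borel}"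

definition adapted :: "(real \<Rightarrow> 'w measure) \<Rightarrow> (real \<Rightarrow> 'w \<Rightarrow> 'a::topological_space) \<Rightarrow> bool" where
  "adapted F Y \<longleftrightarrow> (\<forall>t\<ge>0. Y t \<in> F t \<rightarrow>\<^sub>M borel)"

definition progressively_measurable ::
  "(real \<Rightarrow> 'w measure) \<Rightarrow> (real \<Rightarrow> 'w \<Rightarrow> 'a::topological_space) \<Rightarrow> bool" where
  "progressively_measurable F Y \<longleftrightarrow>
     (\<forall>t\<ge>0. (\<lambda>(s, \<omega>). Y s \<omega>) \<in> restrict_space borel {0..t} \<Otimes>\<^sub>M F t \<rightarrow>\<^sub>M borel)"

definition right_continuous_path :: "(real \<Rightarrow> 'a::topological_space) \<Rightarrow> bool" where
  "right_continuous_path p \<longleftrightarrow> (\<forall>t\<ge>0. continuous (at_right t) p)"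

definition martingale :: "'w measure \<Rightarrow> (real \<Rightarrow> 'w measure) \<Rightarrow> (real \<Rightarrow> 'w \<Rightarrow> real) \<Rightarrow> bool" where
  "martingale M F Y \<longleftrightarrow>
     adapted F Y \<and> (\<forall>t\<ge>0. integrable M (Y t)) \<and>
     (\<forall>s t. 0 \<le> s \<longrightarrow> s \<le> t \<longrightarrow> (AE \<omega> in M. real_cond_exp M (F s) (Y t) \<omega> = Y s \<omega>))"

text \<open>As usual, a local martingale has (almost surely) right-continuous paths. Localizing times may
  be taken finite: if \<open>T k\<close> is a localizing sequence with values in \<open>[0, \<infinity>]\<close>, then so
  is \<open>min (T k) k\<close>.\<close>

definition local_martingale ::
  "'w measure \<Rightarrow> (real \<Rightarrow> 'w measure) \<Rightarrow> (real \<Rightarrow> 'w \<Rightarrow> real) \<Rightarrow> bool" where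
  "local_martingale M F Y \<longleftrightarrow>
     adapted F Y \<and> (AE \<omega> in M. right_continuous_path (\<lambda>t. Y t \<omega>)) \<and>
     (\<exists>T :: nat \<Rightarrow> 'w \<Rightarrow> real.
        (\<forall>k. stopping_time F (T k) \<and> (\<forall>\<omega>\<in>space M. 0 \<le> T k \<omega>)) \<and>
        (AE \<omega> in M. incseq (\<lambda>k. T k \<omega>) \<and> filterlim (\<lambda>k. T k \<omega>) at_top sequentially) \<and>
        (\<forall>k. martingale M F (\<lambda>t \<omega>. Y (min t (T k \<omega>)) \<omega>)))"


section \<open>Markov processes\<close>

definition transition_function :: "(real \<Rightarrow> 'a::polish_space \<Rightarrow> 'a measure) \<Rightarrow> bool" where
  "transition_function K \<longleftrightarrow>
     (\<forall>t\<ge>0. K t \<in> borel \<rightarrow>\<^sub>M prob_algebra borel) \<and>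
     (\<forall>x. K 0 x = return borel x) \<and>
     (\<forall>s\<ge>0. \<forall>t\<ge>0. \<forall>x. K (s + t) x = K s x \<bind> K t)"

text \<open>Only the \<open>\<sigma>\<close>-algebra of \<open>M\<close> is used; \<open>P x\<close> is the law of the process started
  at \<open>x\<close>.\<close>

locale markov_process =
  fixes M :: "'w measure"
    and P :: "'a::polish_space \<Rightarrow> 'w measure"
    and X :: "real \<Rightarrow> 'w \<Rightarrow> 'a"
    and K :: "real \<Rightarrow> 'a \<Rightarrow> 'a measure"
  assumes transition_function: "transition_function K"
    and prob_space_P: "\<And>x. prob_space (P x)"
    and sets_P: "\<And>x. sets (P x) = sets M"
    and measurable_X: "\<And>t. 0 \<le> t \<Longrightarrow> X t \<in> M \<rightarrow>\<^sub>M borel"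
    and start: "\<And>x. AE \<omega> in P x. X 0 \<omega> = x"
    and markov_property: "\<And>x s t A. 0 \<le> s \<Longrightarrow> 0 \<le> t \<Longrightarrow> A \<in> sets borel \<Longrightarrow>
      AE \<omega> in P x. real_cond_exp (P x) (natural_filtration M X s)
        (\<lambda>\<omega>. indicator A (X (s + t) \<omega>)) \<omega> = measure (K t (X s \<omega>)) A"

definition hitting_time :: "(real \<Rightarrow> 'w \<Rightarrow> 'a) \<Rightarrow> 'a set \<Rightarrow> 'w \<Rightarrow> ereal" where
  "hitting_time X A \<omega> = Inf (ereal ` {t. 0 \<le> t \<and> X t \<omega> \<in> A})"

text \<open>Non-explosion along an exhausting sequence: the exit times tend to infinity almost surely.\<close>

definition non_explosive ::
  "('a \<Rightarrow> 'w measure) \<Rightarrow> (real \<Rightarrow> 'w \<Rightarrow> 'a) \<Rightarrow> (nat \<Rightarrow> 'a set) \<Rightarrow> bool" where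
  "non_explosive P X E \<longleftrightarrow>
     (\<forall>x. AE \<omega> in P x. (\<lambda>n. hitting_time X (- E n) \<omega>) \<longlonglongrightarrow> \<infinity>)"


section \<open>Extended generator\<close>

text \<open>A function \<open>g\<close> is a version of \<open>Lf\<close>; it is in general not unique. Pathwise local integrability
  is what gives the integral in the definition its meaning.\<close>

definition generator_pair ::
  "'w measure \<Rightarrow> ('a::topological_space \<Rightarrow> 'w measure) \<Rightarrow> (real \<Rightarrow> 'w \<Rightarrow> 'a) \<Rightarrow>
     ('a \<Rightarrow> real) \<Rightarrow> ('a \<Rightarrow> real) \<Rightarrow> bool" where
  "generator_pair M P X f g \<longleftrightarrow>
     f \<in> borel_measurable borel \<and> g \<in> borel_measurable borel \<and>
     (\<forall>x. (AE \<omega> in P x. \<forall>t\<ge>0. set_integrable lborel {0..t} (\<lambda>s. g (X s \<omega>))) \<and>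
       local_martingale (P x) (natural_filtration M X)
         (\<lambda>t \<omega>. f (X t \<omega>) - f (X 0 \<omega>) - (LINT s:{0..t}|lborel. g (X s \<omega>))))"

definition extended_domain ::
  "'w measure \<Rightarrow> ('a::topological_space \<Rightarrow> 'w measure) \<Rightarrow> (real \<Rightarrow> 'w \<Rightarrow> 'a) \<Rightarrow> ('a \<Rightarrow> real) set" where
  "extended_domain M P X = {f. \<exists>g. generator_pair M P X f g}"

definition extended_generator ::
  "'w measure \<Rightarrow> ('a::topological_space \<Rightarrow> 'w measure) \<Rightarrow> (real \<Rightarrow> 'w \<Rightarrow> 'a) \<Rightarrow>
     (('a \<Rightarrow> real) \<Rightarrow> 'a \<Rightarrow> real) \<Rightarrow> bool" where
  "extended_generator M P X L \<longleftrightarrow> (\<forall>f\<in>extended_domain M P X. generator_pair M P X f (L f))"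


section \<open>Ergodicity\<close>

definition invariant_measure ::
  "(real \<Rightarrow> 'a::topological_space \<Rightarrow> 'a measure) \<Rightarrow> 'a measure \<Rightarrow> bool" where
  "invariant_measure K \<pi> \<longleftrightarrow>
     sets \<pi> = sets borel \<and> sigma_finite_measure \<pi> \<and>
     (\<forall>t>0. \<forall>A\<in>sets borel. emeasure \<pi> A = (\<integral>\<^sup>+x. emeasure (K t x) A \<partial>\<pi>))"

text \<open>For probability measures the supremum is over a bounded set. The other common normalization
  of the total variation distance differs by a factor of 2, which does not affect the notions below.\<close>

definition tv_dist :: "'a::topological_space measure \<Rightarrow> 'a measure \<Rightarrow> real" where
  "tv_dist \<mu> \<nu> = (SUP A\<in>sets borel. \<bar>measure \<mu> A - measure \<nu> A\<bar>)"

definition ergodic :: "(real \<Rightarrow> 'a::topological_space \<Rightarrow> 'a measure) \<Rightarrow> 'a measure \<Rightarrow> bool" where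
  "ergodic K \<pi> \<longleftrightarrow>
     invariant_measure K \<pi> \<and> prob_space \<pi> \<and>
     (\<forall>\<nu>. invariant_measure K \<nu> \<and> prob_space \<nu> \<longrightarrow> \<nu> = \<pi>) \<and>
     (\<forall>x. ((\<lambda>t. tv_dist (K t x) \<pi>) \<longlongrightarrow> 0) at_top)"

definition strongly_ergodic :: "(real \<Rightarrow> 'a::topological_space \<Rightarrow> 'a measure) \<Rightarrow> bool" where
  "strongly_ergodic K \<longleftrightarrow>
     (\<exists>\<epsilon>>0. \<exists>C>0. \<exists>\<pi>. invariant_measure K \<pi> \<and> prob_space \<pi> \<and>
        (\<forall>t\<ge>0. \<forall>x. tv_dist (K t x) \<pi> \<le> C * exp (- \<epsilon> * t)))"


section \<open>Test functions\<close>

definition norm_like :: "('a::topological_space \<Rightarrow> real) \<Rightarrow> bool" where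
  "norm_like f \<longleftrightarrow>
     f \<in> borel_measurable borel \<and> (\<forall>x. 0 \<le> f x) \<and> (\<forall>r>0. compact (closure {x. f x \<le> r}))"

text \<open>Local boundedness is understood relative to the bounded sets of the metric, as these are also
  the sets exhausting the state space. Boundedness near every point would be weaker, because
  bounded sets of a Polish space need not be relatively compact.\<close>

definition locally_bounded :: "('a::metric_space \<Rightarrow> real) \<Rightarrow> bool" where
  "locally_bounded f \<longleftrightarrow> (\<forall>B. bounded B \<longrightarrow> bounded (f ` B))"

end

theory Submission
  imports Defs
begin

text \<open>Suppose that the process is strongly ergodic. Then \<open>P_t(x, H) \<ge> \<pi>(H) / 2\<close> for all \<open>x\<close> and
  all large \<open>t\<close>, so the first time \<open>\<sigma>\<close> after which the process spends positive time in \<open>H\<close>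
  satisfies \<open>E_x \<sigma> \<le> R\<close> with \<open>R\<close> independent of \<open>x\<close>. Up to \<open>\<sigma>\<close> we have \<open>Lu \<ge> -1\<close> and
  \<open>Lv \<le> 0\<close> at almost every time. Stopping at \<open>\<rho> = \<sigma> \<and> T_k \<and> k\<close> with localizing times \<open>T_k\<close>
  gives \<open>u(x) \<le> E_x u(X_\<rho>) + E_x \<rho>\<close> and \<open>E_x v(X_\<rho>) \<le> v(x)\<close>. By (c), \<open>u \<le> e v + C_e\<close> for every
  \<open>e > 0\<close>, while \<open>u(X_\<rho>) \<le> sup_H u\<close> if \<open>\<rho> = \<sigma> < k\<close>. The limits \<open>k \<rightarrow> \<infinity>\<close> and then \<open>e \<rightarrow> 0\<close> yield
  \<open>u \<le> sup_H u + R\<close>. So the space, being a sublevel set of \<open>u\<close>, is compact and equals some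
  \<open>E n\<close>. Then the suprema in (c) are over empty sets and equal \<open>-\<infinity>\<close>, which does not tend to 0.\<close>

section \<open>Optional stopping\<close>

lemma martingale_integral_indicator:
  assumes "prob_space M" and sub: "subalgebra M (F s)"
    and Y: "martingale M F Y" and st: "0 \<le> s" "s \<le> t" and A: "A \<in> sets (F s)"
  shows "(\<integral>\<omega>. indicator A \<omega> * Y t \<omega> \<partial>M) = (\<integral>\<omega>. indicator A \<omega> * Y s \<omega> \<partial>M)"
proof -
  interpret prob_space M by fact
  interpret finite_measure_subalgebra M "F s"
    using sub by unfold_locales
  have Yt: "integrable M (Y t)" "integrable M (Y s)"
    using Y st by (auto simp: martingale_def)
  have [measurable]: "A \<in> sets M"
    using A sub by (auto simp: subalgebra_def)
  have "(\<integral>\<omega>. indicator A \<omega> * Y t \<omega> \<partial>M) = (\<integral>\<omega>. indicator A \<omega> * real_cond_exp M (F s) (Y t) \<omega> \<partial>M)"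
    using real_cond_exp_intA[OF Yt(1) A] by (simp add: set_lebesgue_integral_def)
  also have "\<dots> = (\<integral>\<omega>. indicator A \<omega> * Y s \<omega> \<partial>M)"
  proof (rule integral_cong_AE)
    have "AE \<omega> in M. real_cond_exp M (F s) (Y t) \<omega> = Y s \<omega>"
      using Y st by (auto simp: martingale_def)
    then show "AE \<omega> in M. indicator A \<omega> * real_cond_exp M (F s) (Y t) \<omega> = indicator A \<omega> * Y s \<omega>"
      by eventually_elim simp
  qed (use Yt in measurable)
  finally show ?thesis .
qed

text \<open>A conditional Jensen inequality for the convex function
  \<open>max 0 (\<bar>y\<bar> - c)\<close>, done by hand. On the sets \<open>U\<close> and
  \<open>V\<close>, known at time \<open>s\<close>, where \<open>Y s\<close> exceeds
  \<open>c\<close> or lies below \<open>- c\<close>, the excess is affine in \<open>Y s\<close>, so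
  \<open>Y s\<close> may be exchanged for \<open>Y t\<close> under the integral. The resulting
  affine expression lies below the excess of \<open>Y t\<close>.\<close>

lemma martingale_excess_mono:
  fixes c :: real
  assumes M: "prob_space M" and sub: "subalgebra M (F s)"
    and Y: "martingale M F Y" and st: "0 \<le> s" "s \<le> t" and A: "A \<in> sets (F s)" and c: "0 \<le> c"
  shows "(\<integral>\<omega>. indicator A \<omega> * max 0 (\<bar>Y s \<omega>\<bar> - c) \<partial>M) \<le> (\<integral>\<omega>. indicator A \<omega> * max 0 (\<bar>Y t \<omega>\<bar> - c) \<partial>M)"
proof -
  interpret prob_space M by fact
  have Yt [simp]: "integrable M (Y t)" "integrable M (Y s)"
    using Y st by (auto simp: martingale_def)
  have [measurable]: "Y s \<in> borel_measurable (F s)"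
    using Y st by (auto simp: martingale_def adapted_def)
  have sp: "space (F s) = space M" using sub by (simp add: subalgebra_def)
  define U where "U = A \<inter> {\<omega> \<in> space (F s). c < Y s \<omega>}"
  define V where "V = A \<inter> {\<omega> \<in> space (F s). Y s \<omega> < - c}"
  have U: "U \<in> sets (F s)" and V: "V \<in> sets (F s)"
    using A by (auto simp: U_def V_def)
  have UVA [measurable]: "U \<in> sets M" "V \<in> sets M" "A \<in> sets M"
    using U V A sub by (auto simp: subalgebra_def)
  have int: "integrable M (\<lambda>\<omega>. indicator B \<omega> * f \<omega>)" if "B \<in> sets M" "integrable M f" for B and f :: "'a \<Rightarrow> real"
    using integrable_mult_indicator[OF that] by simp
  have "(\<integral>\<omega>. indicator A \<omega> * max 0 (\<bar>Y s \<omega>\<bar> - c) \<partial>M)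
      = (\<integral>\<omega>. (indicator U \<omega> * Y s \<omega> - indicator U \<omega> * c) - (indicator V \<omega> * Y s \<omega> + indicator V \<omega> * c) \<partial>M)"
    using c by (intro Bochner_Integration.integral_cong)
      (auto simp: U_def V_def indicator_def sp)
  also have "\<dots> = ((\<integral>\<omega>. indicator U \<omega> * Y s \<omega> \<partial>M) - (\<integral>\<omega>. indicator U \<omega> * c \<partial>M))
      - ((\<integral>\<omega>. indicator V \<omega> * Y s \<omega> \<partial>M) + (\<integral>\<omega>. indicator V \<omega> * c \<partial>M))"
    by (subst Bochner_Integration.integral_diff Bochner_Integration.integral_add;
        (intro Bochner_Integration.integrable_diff Bochner_Integration.integrable_add int UVA Yt)?; simp)+
  also have "\<dots> = ((\<integral>\<omega>. indicator U \<omega> * Y t \<omega> \<partial>M) - (\<integral>\<omega>. indicator U \<omega> * c \<partial>M))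
      - ((\<integral>\<omega>. indicator V \<omega> * Y t \<omega> \<partial>M) + (\<integral>\<omega>. indicator V \<omega> * c \<partial>M))"
    using martingale_integral_indicator[where F=F, OF M sub Y st U] martingale_integral_indicator[where F=F, OF M sub Y st V]
    by simp
  also have "\<dots> = (\<integral>\<omega>. (indicator U \<omega> * Y t \<omega> - indicator U \<omega> * c) - (indicator V \<omega> * Y t \<omega> + indicator V \<omega> * c) \<partial>M)"
    by (subst Bochner_Integration.integral_diff Bochner_Integration.integral_add;
        (intro Bochner_Integration.integrable_diff Bochner_Integration.integrable_add int UVA Yt)?; simp)+
  also have "\<dots> \<le> (\<integral>\<omega>. indicator A \<omega> * max 0 (\<bar>Y t \<omega>\<bar> - c) \<partial>M)"
  proof (rule integral_mono)
    show "integrable M (\<lambda>\<omega>. (indicator U \<omega> * Y t \<omega> - indicator U \<omega> * c) - (indicator V \<omega> * Y t \<omega> + indicator V \<omega> * c))"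
      by (intro Bochner_Integration.integrable_diff Bochner_Integration.integrable_add int UVA Yt; simp)
    show "integrable M (\<lambda>\<omega>. indicator A \<omega> * max 0 (\<bar>Y t \<omega>\<bar> - c))"
      by (intro int UVA integrable_max Bochner_Integration.integrable_diff integrable_abs Yt; simp)
  qed (use c in \<open>auto simp: U_def V_def indicator_def\<close>)
  finally show ?thesis .
qed

text \<open>Split the space along the finitely many values \<open>g\<close> of
  \<open>\<tau>\<close>: each level set is known at time \<open>g\<close>, so on it
  \<open>Y g\<close> and \<open>Y t\<close> have the same integral. The third conclusion bounds the
  truncated moments by those of the single variable \<open>Y t\<close>, whatever
  \<open>\<tau>\<close> is; this supplies the uniform integrability for the passage to general
  stopping times.\<close>

lemma martingale_finite_stopping:
  fixes Y :: "real \<Rightarrow> 'w \<Rightarrow> real" and \<tau> :: "'w \<Rightarrow> real"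
  assumes M: "prob_space M" and sub: "\<And>s. subalgebra M (F s)" and Y: "martingale M F Y"
    and G: "finite G" "G \<subseteq> {0..t}" and \<tau>: "\<And>\<omega>. \<omega> \<in> space M \<Longrightarrow> \<tau> \<omega> \<in> G"
    and \<tau>_sets: "\<And>g. g \<in> G \<Longrightarrow> {\<omega> \<in> space M. \<tau> \<omega> = g} \<in> sets (F g)"
  shows "integrable M (\<lambda>\<omega>. Y (\<tau> \<omega>) \<omega>)"
    and "(\<integral>\<omega>. Y (\<tau> \<omega>) \<omega> \<partial>M) = (\<integral>\<omega>. Y t \<omega> \<partial>M)"
    and "0 \<le> c \<Longrightarrow> (\<integral>\<omega>. max 0 (\<bar>Y (\<tau> \<omega>) \<omega>\<bar> - c) \<partial>M) \<le> (\<integral>\<omega>. max 0 (\<bar>Y t \<omega>\<bar> - c) \<partial>M)"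
proof -
  interpret prob_space M by fact
  define A where "A g = {\<omega> \<in> space M. \<tau> \<omega> = g}" for g
  have A: "A g \<in> sets (F g)" "A g \<in> sets M" if "g \<in> G" for g
    using \<tau>_sets[OF that] sub[of g] by (auto simp: A_def subalgebra_def)
  have split: "(\<Sum>g\<in>G. indicator (A g) \<omega> * f g) = f (\<tau> \<omega>)" if "\<omega> \<in> space M" for \<omega> and f :: "real \<Rightarrow> real"
  proof -
    have "(\<Sum>g\<in>G. indicator (A g) \<omega> * f g) = (\<Sum>g\<in>G. if g = \<tau> \<omega> then f g else 0)"
      using that by (intro sum.cong) (auto simp: A_def)
    then show ?thesis using \<tau>[OF that] G by simp
  qed
  have int: "integrable M (\<lambda>\<omega>. indicator B \<omega> * f \<omega>)" if "B \<in> sets M" "integrable M f" for B and f :: "'w \<Rightarrow> real"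
    using integrable_mult_indicator[OF that] by simp
  have G0: "0 \<le> g" "g \<le> t" if "g \<in> G" for g using that G by auto
  have Yg: "integrable M (Y g)" if "g \<in> G" for g
    using Y G0[OF that] by (auto simp: martingale_def)
  have int_split: "integrable M (\<lambda>\<omega>. f (\<tau> \<omega>) \<omega>)"
    "(\<integral>\<omega>. f (\<tau> \<omega>) \<omega> \<partial>M) = (\<Sum>g\<in>G. \<integral>\<omega>. indicator (A g) \<omega> * f g \<omega> \<partial>M)"
    if f: "\<And>g. g \<in> G \<Longrightarrow> integrable M (f g)" for f :: "real \<Rightarrow> 'w \<Rightarrow> real"
  proof -
    have I: "integrable M (\<lambda>\<omega>. \<Sum>g\<in>G. indicator (A g) \<omega> * f g \<omega>)"
      by (intro Bochner_Integration.integrable_sum int A f)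
    then show "integrable M (\<lambda>\<omega>. f (\<tau> \<omega>) \<omega>)"
      using split by (subst Bochner_Integration.integrable_cong[OF refl, where g="\<lambda>\<omega>. \<Sum>g\<in>G. indicator (A g) \<omega> * f g \<omega>"]) auto
    have "(\<integral>\<omega>. f (\<tau> \<omega>) \<omega> \<partial>M) = (\<integral>\<omega>. (\<Sum>g\<in>G. indicator (A g) \<omega> * f g \<omega>) \<partial>M)"
      using split by (intro Bochner_Integration.integral_cong) auto
    also have "\<dots> = (\<Sum>g\<in>G. \<integral>\<omega>. indicator (A g) \<omega> * f g \<omega> \<partial>M)"
      by (intro Bochner_Integration.integral_sum int A f)
    finally show "(\<integral>\<omega>. f (\<tau> \<omega>) \<omega> \<partial>M) = (\<Sum>g\<in>G. \<integral>\<omega>. indicator (A g) \<omega> * f g \<omega> \<partial>M)" .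
  qed
  show "integrable M (\<lambda>\<omega>. Y (\<tau> \<omega>) \<omega>)"
    using Yg by (rule int_split)
  obtain g where "g \<in> G"
    using \<tau> not_empty by auto
  then have "0 \<le> t" using G0[of g] by linarith
  then have Yt: "integrable M (Y t)"
    using Y by (auto simp: martingale_def)
  have "(\<integral>\<omega>. Y (\<tau> \<omega>) \<omega> \<partial>M) = (\<Sum>g\<in>G. \<integral>\<omega>. indicator (A g) \<omega> * Y g \<omega> \<partial>M)"
    using Yg by (rule int_split)
  also have "\<dots> = (\<Sum>g\<in>G. \<integral>\<omega>. indicator (A g) \<omega> * Y t \<omega> \<partial>M)"
    using G0 A by (intro sum.cong refl martingale_integral_indicator[where F=F, OF M sub Y, symmetric]) auto
  also have "\<dots> = (\<integral>\<omega>. Y t \<omega> \<partial>M)"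
    using Yt by (rule int_split(2)[symmetric])
  finally show "(\<integral>\<omega>. Y (\<tau> \<omega>) \<omega> \<partial>M) = (\<integral>\<omega>. Y t \<omega> \<partial>M)" .
  assume c: "0 \<le> c"
  have ex: "integrable M (\<lambda>\<omega>. max 0 (\<bar>f \<omega>\<bar> - c))" if "integrable M f" for f :: "'w \<Rightarrow> real"
    using that by (intro integrable_max Bochner_Integration.integrable_diff integrable_abs) auto
  have "(\<integral>\<omega>. max 0 (\<bar>Y (\<tau> \<omega>) \<omega>\<bar> - c) \<partial>M) = (\<Sum>g\<in>G. \<integral>\<omega>. indicator (A g) \<omega> * max 0 (\<bar>Y g \<omega>\<bar> - c) \<partial>M)"
    using int_split(2)[of "\<lambda>g \<omega>. max 0 (\<bar>Y g \<omega>\<bar> - c)"] ex Yg by auto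
  also have "\<dots> \<le> (\<Sum>g\<in>G. \<integral>\<omega>. indicator (A g) \<omega> * max 0 (\<bar>Y t \<omega>\<bar> - c) \<partial>M)"
    using martingale_excess_mono[where F=F, OF M sub Y _ _ _ c] G0 A by (intro sum_mono) auto
  also have "\<dots> = (\<integral>\<omega>. max 0 (\<bar>Y t \<omega>\<bar> - c) \<partial>M)"
    using int_split(2)[of "\<lambda>g \<omega>. max 0 (\<bar>Y t \<omega>\<bar> - c)"] ex Yt by auto
  finally show "(\<integral>\<omega>. max 0 (\<bar>Y (\<tau> \<omega>) \<omega>\<bar> - c) \<partial>M) \<le> (\<integral>\<omega>. max 0 (\<bar>Y t \<omega>\<bar> - c) \<partial>M)" .
qed

section \<open>Uniform integrability through truncated moments\<close>

lemma integral_excess_tendsto_0: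
  fixes f :: "'a \<Rightarrow> real"
  assumes f: "integrable M f"
  shows "(\<lambda>n. \<integral>x. max 0 (\<bar>f x\<bar> - real n) \<partial>M) \<longlonglongrightarrow> 0"
proof -
  have [measurable]: "f \<in> borel_measurable M" using f by simp
  have "(\<lambda>n. \<integral>x. max 0 (\<bar>f x\<bar> - real n) \<partial>M) \<longlonglongrightarrow> (\<integral>x. 0 \<partial>M)"
  proof (rule integral_dominated_convergence)
    show "integrable M (\<lambda>x. \<bar>f x\<bar>)" using f by simp
    show "AE x in M. (\<lambda>n. max 0 (\<bar>f x\<bar> - real n)) \<longlonglongrightarrow> 0"
    proof (rule AE_I2)
      fix x
      obtain N where "\<bar>f x\<bar> \<le> real N" using real_arch_simple by blast
      then have "\<forall>\<^sub>F n in sequentially. max 0 (\<bar>f x\<bar> - real n) = 0"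
        by (intro eventually_sequentiallyI[of N]) auto
      then show "(\<lambda>n. max 0 (\<bar>f x\<bar> - real n)) \<longlonglongrightarrow> 0"
        by (rule tendsto_eventually)
    qed
  qed auto
  then show ?thesis by simp
qed

text \<open>The bound on the truncated moments expresses uniform integrability of \<open>Z\<close>.\<close>

lemma (in finite_measure) integral_tendsto_of_excess_bound:
  fixes Z :: "nat \<Rightarrow> 'a \<Rightarrow> real" and f :: "'a \<Rightarrow> real"
  assumes Zn: "\<And>n. integrable M (Z n)" and f: "integrable M f"
    and excess: "\<And>n k. (\<integral>x. max 0 (\<bar>Z n x\<bar> - real k) \<partial>M) \<le> (\<integral>x. max 0 (\<bar>f x\<bar> - real k) \<partial>M)"
    and W [measurable]: "W \<in> borel_measurable M"
    and lim: "AE x in M. (\<lambda>n. Z n x) \<longlonglongrightarrow> W x"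
  shows "integrable M W" and "(\<lambda>n. \<integral>x. Z n x \<partial>M) \<longlonglongrightarrow> (\<integral>x. W x \<partial>M)"
proof -
  have [measurable]: "Z n \<in> borel_measurable M" for n using Zn by simp
  define e where "e k = (\<integral>x. max 0 (\<bar>f x\<bar> - real k) \<partial>M)" for k :: nat
  have ex: "integrable M (\<lambda>\<omega>. max 0 (\<bar>g \<omega>\<bar> - c))" if "integrable M g" for g :: "'a \<Rightarrow> real" and c
    using that by (intro integrable_max Bochner_Integration.integrable_diff integrable_abs) auto
  \<comment> \<open>Fatou's lemma hands the excess bound on to the limit \<open>W\<close>; level
    \<open>k = 0\<close> then yields its integrability.\<close>
  have fatou: "(\<integral>\<^sup>+x. ennreal (max 0 (\<bar>W x\<bar> - real k)) \<partial>M) \<le> ennreal (e k)" for k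
  proof -
    have "(\<integral>\<^sup>+x. ennreal (max 0 (\<bar>W x\<bar> - real k)) \<partial>M) = (\<integral>\<^sup>+x. liminf (\<lambda>n. ennreal (max 0 (\<bar>Z n x\<bar> - real k))) \<partial>M)"
    proof (rule nn_integral_cong_AE, use lim in eventually_elim)
      fix x assume "(\<lambda>n. Z n x) \<longlonglongrightarrow> W x"
      then have "(\<lambda>n. ennreal (max 0 (\<bar>Z n x\<bar> - real k))) \<longlonglongrightarrow> ennreal (max 0 (\<bar>W x\<bar> - real k))"
        by (intro tendsto_intros)
      then show "ennreal (max 0 (\<bar>W x\<bar> - real k)) = liminf (\<lambda>n. ennreal (max 0 (\<bar>Z n x\<bar> - real k)))"
        by (simp add: lim_imp_Liminf)
    qed
    also have "\<dots> \<le> liminf (\<lambda>n. \<integral>\<^sup>+x. ennreal (max 0 (\<bar>Z n x\<bar> - real k)) \<partial>M)"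
      by (rule nn_integral_liminf) auto
    also have "\<dots> \<le> liminf (\<lambda>n::nat. ennreal (e k))"
    proof (intro Liminf_mono always_eventually allI)
      fix n
      have "(\<integral>\<^sup>+x. ennreal (max 0 (\<bar>Z n x\<bar> - real k)) \<partial>M) = ennreal (\<integral>x. max 0 (\<bar>Z n x\<bar> - real k) \<partial>M)"
        using ex[OF Zn] by (intro nn_integral_eq_integral) auto
      also have "\<dots> \<le> ennreal (e k)" using excess by (auto simp: e_def intro: ennreal_leI)
      finally show "(\<integral>\<^sup>+x. ennreal (max 0 (\<bar>Z n x\<bar> - real k)) \<partial>M) \<le> ennreal (e k)" .
    qed
    also have "\<dots> = ennreal (e k)" by (simp add: Liminf_const)
    finally show ?thesis .
  qed
  show W_int: "integrable M W"
  proof (rule integrableI_bounded)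
    have "(\<integral>\<^sup>+x. ennreal (norm (W x)) \<partial>M) = (\<integral>\<^sup>+x. ennreal (max 0 (\<bar>W x\<bar> - real 0)) \<partial>M)"
      by (intro nn_integral_cong) simp
    also have "\<dots> < \<infinity>" using fatou[of 0] by (simp add: order_le_less_trans)
    finally show "(\<integral>\<^sup>+x. ennreal (norm (W x)) \<partial>M) < \<infinity>" .
  qed simp
  have excess_W: "(\<integral>x. max 0 (\<bar>W x\<bar> - real k) \<partial>M) \<le> e k" for k
  proof -
    have "ennreal (\<integral>x. max 0 (\<bar>W x\<bar> - real k) \<partial>M) = (\<integral>\<^sup>+x. ennreal (max 0 (\<bar>W x\<bar> - real k)) \<partial>M)"
      using ex[OF W_int] by (intro nn_integral_eq_integral[symmetric]) auto
    also have "\<dots> \<le> ennreal (e k)" by (rule fatou)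
    finally show ?thesis by (subst (asm) ennreal_le_iff) (auto simp: e_def)
  qed
  \<comment> \<open>Clipping at level \<open>k\<close> moves \<open>y\<close> by exactly the excess
    \<open>max 0 (\<bar>y\<bar> - k)\<close>. It thus changes the integrals of \<open>Z n\<close>
    and \<open>W\<close> by at most \<open>e k\<close>, uniformly in \<open>n\<close>, while the
    clipped functions are bounded and obey dominated convergence. Each of the three errors gets
    \<open>r / 3\<close>.\<close>
  define \<phi> where "\<phi> k y = max (- real k) (min (real k) y)" for k :: nat and y :: real
  have \<phi>_meas [measurable]: "\<phi> k \<in> borel_measurable borel" for k unfolding \<phi>_def by measurable
  have \<phi>_int: "integrable M (\<lambda>x. \<phi> k (g x))" if [measurable]: "g \<in> borel_measurable M" for k g
    by (rule integrable_const_bound[of _ "real k"]) (auto simp: \<phi>_def)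
  have \<phi>_near: "\<bar>(\<integral>x. g x \<partial>M) - (\<integral>x. \<phi> k (g x) \<partial>M)\<bar> \<le> e k"
    if g: "integrable M g" "(\<integral>x. max 0 (\<bar>g x\<bar> - real k) \<partial>M) \<le> e k" for g k
  proof -
    have "\<bar>(\<integral>x. g x \<partial>M) - (\<integral>x. \<phi> k (g x) \<partial>M)\<bar> = \<bar>\<integral>x. g x - \<phi> k (g x) \<partial>M\<bar>"
      using g \<phi>_int by simp
    also have "\<dots> \<le> (\<integral>x. \<bar>g x - \<phi> k (g x)\<bar> \<partial>M)"
      by (rule integral_abs_bound)
    also have "\<dots> \<le> (\<integral>x. max 0 (\<bar>g x\<bar> - real k) \<partial>M)"
      using g \<phi>_int ex by (intro integral_mono) (auto simp: \<phi>_def)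
    finally show ?thesis using g by simp
  qed
  show "(\<lambda>n. \<integral>x. Z n x \<partial>M) \<longlonglongrightarrow> (\<integral>x. W x \<partial>M)"
  proof (rule LIMSEQ_I)
    fix r :: real assume "0 < r"
    have "e \<longlonglongrightarrow> 0" unfolding e_def by (rule integral_excess_tendsto_0[OF f])
    then have "\<forall>\<^sub>F k in sequentially. e k < r / 3"
      using \<open>0 < r\<close> by (intro order_tendstoD(2)) auto
    then obtain k where k: "e k < r / 3"
      using eventually_happens'[OF sequentially_bot] by blast
    have "(\<lambda>n. \<integral>x. \<phi> k (Z n x) \<partial>M) \<longlonglongrightarrow> (\<integral>x. \<phi> k (W x) \<partial>M)"
    proof (rule integral_dominated_convergence)
      show "integrable M (\<lambda>x. real k)" by simp
      show "AE x in M. (\<lambda>n. \<phi> k (Z n x)) \<longlonglongrightarrow> \<phi> k (W x)"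
        using lim by eventually_elim (auto simp: \<phi>_def intro!: tendsto_intros)
      show "AE x in M. norm (\<phi> k (Z n x)) \<le> real k" for n
        by (auto simp: \<phi>_def)
    qed auto
    then obtain N where N: "\<And>n. n \<ge> N \<Longrightarrow> \<bar>(\<integral>x. \<phi> k (Z n x) \<partial>M) - (\<integral>x. \<phi> k (W x) \<partial>M)\<bar> < r / 3"
      using LIMSEQ_D[of _ _ "r/3"] \<open>0 < r\<close> by fastforce
    have "\<bar>(\<integral>x. Z n x \<partial>M) - (\<integral>x. W x \<partial>M)\<bar> < r" if "n \<ge> N" for n
    proof -
      have "\<bar>(\<integral>x. Z n x \<partial>M) - (\<integral>x. \<phi> k (Z n x) \<partial>M)\<bar> \<le> e k"
        using excess by (intro \<phi>_near[OF Zn]) (simp add: e_def)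
      moreover have "\<bar>(\<integral>x. W x \<partial>M) - (\<integral>x. \<phi> k (W x) \<partial>M)\<bar> \<le> e k"
        by (rule \<phi>_near[OF W_int excess_W])
      ultimately show ?thesis using N[OF that] k by linarith
    qed
    then show "\<exists>no. \<forall>n\<ge>no. norm ((\<integral>x. Z n x \<partial>M) - (\<integral>x. W x \<partial>M)) < r" by auto
  qed
qed

text \<open>Only \<open>{\<rho> < s} \<in> F s\<close> is required, so \<open>\<rho>\<close> is a stopping time of the right-continuous
  enlargement of \<open>F\<close>. This suffices because \<open>\<rho>\<close> is approximated by grid times that are strictly
  larger. The variable \<open>W\<close> is a measurable version of the stopped value.\<close>

lemma optional_stopping:
  fixes Y :: "real \<Rightarrow> 'w \<Rightarrow> real" and \<rho> :: "'w \<Rightarrow> real"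
  assumes M: "prob_space M" and sub: "\<And>s. subalgebra M (F s)"
    and mono: "\<And>s t. s \<le> t \<Longrightarrow> sets (F s) \<subseteq> sets (F t)"
    and Y: "martingale M F Y" and rc: "AE \<omega> in M. right_continuous_path (\<lambda>t. Y t \<omega>)"
    and \<rho>: "\<And>\<omega>. \<omega> \<in> space M \<Longrightarrow> 0 \<le> \<rho> \<omega> \<and> \<rho> \<omega> \<le> b"
    and optional: "\<And>s. {\<omega> \<in> space M. \<rho> \<omega> < s} \<in> sets (F s)"
  obtains W where "integrable M W" "AE \<omega> in M. Y (\<rho> \<omega>) \<omega> = W \<omega>" "(\<integral>\<omega>. W \<omega> \<partial>M) = (\<integral>\<omega>. Y 0 \<omega> \<partial>M)"
proof -
  interpret prob_space M by fact
  obtain \<omega>0 where "\<omega>0 \<in> space M" using not_empty by auto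
  with \<rho>[of \<omega>0] have b: "0 \<le> b" by linarith
  \<comment> \<open>\<open>\<tau> n\<close> is the first point of the grid with mesh
    \<open>1 / (n + 1)\<close> strictly after \<open>\<rho>\<close>. It overshoots
    \<open>\<rho> \<le> b\<close> by at most \<open>1\<close>, so \<open>T\<close> is one horizon
    for all \<open>n\<close>.\<close>
  define T where "T = b + 1"
  define \<tau> where "\<tau> n \<omega> = (of_int \<lfloor>\<rho> \<omega> * real (Suc n)\<rfloor> + 1) / real (Suc n)" for n \<omega>
  define G where "G n = (\<lambda>i. (of_int i + 1) / real (Suc n)) ` {0..\<lfloor>b * real (Suc n)\<rfloor>}" for n
  have \<tau>_gt: "\<rho> \<omega> < \<tau> n \<omega>" for n \<omega>
    unfolding \<tau>_def by (subst pos_less_divide_eq) linarith+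
  have \<tau>_le: "\<tau> n \<omega> \<le> \<rho> \<omega> + 1 / real (Suc n)" for n \<omega>
    unfolding \<tau>_def add_divide_distrib by (intro add_right_mono) (subst pos_divide_le_eq, auto)
  have G_fin: "finite (G n)" for n by (simp add: G_def)
  have G_T: "G n \<subseteq> {0..T}" for n
  proof
    fix g assume "g \<in> G n"
    then obtain i where i: "0 \<le> i" "i \<le> \<lfloor>b * real (Suc n)\<rfloor>" and g: "g = (of_int i + 1) / real (Suc n)"
      by (auto simp: G_def)
    have "of_int i \<le> b * real (Suc n)" using i by linarith
    then have "g \<le> b + 1 / real (Suc n)"
      unfolding g add_divide_distrib by (intro add_right_mono) (subst pos_divide_le_eq, auto)
    also have "\<dots> \<le> T" by (simp add: T_def field_simps)
    finally show "g \<in> {0..T}" using i by (simp add: g)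
  qed
  have \<tau>_G: "\<tau> n \<omega> \<in> G n" if "\<omega> \<in> space M" for n \<omega>
    unfolding \<tau>_def G_def using \<rho>[OF that]
    by (intro imageI) (auto intro!: floor_mono mult_right_mono)
  have \<tau>_sets: "{\<omega> \<in> space M. \<tau> n \<omega> = g} \<in> sets (F g)" if gG: "g \<in> G n" for n g
  proof -
    obtain i where g: "g = (of_int i + 1) / real (Suc n)"
      using gG by (auto simp: G_def simp del: of_nat_Suc)
    \<comment> \<open>\<open>\<tau> n = g\<close> says that \<open>\<rho>\<close> lies in the
      half-open grid cell ending at \<open>g\<close>. This is a difference of two events of the form
      \<open>\<rho> < s\<close> with \<open>s \<le> g\<close>.\<close>
    have "\<tau> n \<omega> = g \<longleftrightarrow> \<rho> \<omega> < g \<and> \<not> \<rho> \<omega> < of_int i / real (Suc n)" for \<omega>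
    proof -
      have "\<tau> n \<omega> = g \<longleftrightarrow> \<lfloor>\<rho> \<omega> * real (Suc n)\<rfloor> = i"
        by (simp add: \<tau>_def g divide_cancel_right del: of_nat_Suc)
      also have "\<dots> \<longleftrightarrow> of_int i \<le> \<rho> \<omega> * real (Suc n) \<and> \<rho> \<omega> * real (Suc n) < of_int i + 1"
        by (rule floor_eq_iff)
      also have "\<dots> \<longleftrightarrow> of_int i / real (Suc n) \<le> \<rho> \<omega> \<and> \<rho> \<omega> < g"
        by (simp add: g pos_divide_le_eq pos_less_divide_eq del: of_nat_Suc)
      finally show ?thesis by auto
    qed
    then have "{\<omega> \<in> space M. \<tau> n \<omega> = g} = {\<omega> \<in> space M. \<rho> \<omega> < g} - {\<omega> \<in> space M. \<rho> \<omega> < of_int i / real (Suc n)}"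
      by auto
    also have "\<dots> \<in> sets (F g)"
    proof (rule sets.Diff[OF optional])
      have "of_int i / real (Suc n) \<le> g" by (simp add: g divide_right_mono)
      from mono[OF this] optional show "{\<omega> \<in> space M. \<rho> \<omega> < of_int i / real (Suc n)} \<in> sets (F g)" by blast
    qed
    finally show ?thesis .
  qed
  note st = martingale_finite_stopping[where F=F, OF M sub Y G_fin G_T \<tau>_G \<tau>_sets]
  have [measurable]: "(\<lambda>\<omega>. Y (\<tau> n \<omega>) \<omega>) \<in> borel_measurable M" for n
    using st(1)[of n] by simp
  \<comment> \<open>By right-continuity the values at the grid times, which are measurable, converge
    to the stopped value almost surely. Adaptedness alone does not make
    \<open>Y (\<rho> \<omega>) \<omega>\<close> measurable in \<open>\<omega>\<close>, hence the
    limit \<open>W\<close>.\<close>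
  define W where "W \<omega> = lim (\<lambda>n. Y (\<tau> n \<omega>) \<omega>)" for \<omega>
  have W [measurable]: "W \<in> borel_measurable M" unfolding W_def by measurable
  have conv: "AE \<omega> in M. (\<lambda>n. Y (\<tau> n \<omega>) \<omega>) \<longlonglongrightarrow> Y (\<rho> \<omega>) \<omega>"
    using rc
  proof (rule AE_mp, intro AE_I2 impI)
    fix \<omega> assume w: "\<omega> \<in> space M" and "right_continuous_path (\<lambda>t. Y t \<omega>)"
    then have "((\<lambda>t. Y t \<omega>) \<longlongrightarrow> Y (\<rho> \<omega>) \<omega>) (at_right (\<rho> \<omega>))"
      using \<rho> by (auto simp: right_continuous_path_def continuous_within)
    moreover have "filterlim (\<lambda>n. \<tau> n \<omega>) (at_right (\<rho> \<omega>)) sequentially"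
      unfolding filterlim_at
    proof (intro conjI)
      show "\<forall>\<^sub>F n in sequentially. \<tau> n \<omega> \<in> {\<rho> \<omega><..} \<and> \<tau> n \<omega> \<noteq> \<rho> \<omega>"
        using \<tau>_gt by (auto simp: less_imp_neq[symmetric])
      show "(\<lambda>n. \<tau> n \<omega>) \<longlonglongrightarrow> \<rho> \<omega>"
      proof (rule real_tendsto_sandwich)
        show "\<forall>\<^sub>F n in sequentially. \<rho> \<omega> \<le> \<tau> n \<omega>" using \<tau>_gt by (intro always_eventually allI less_imp_le)
        show "\<forall>\<^sub>F n in sequentially. \<tau> n \<omega> \<le> \<rho> \<omega> + 1 / real (Suc n)" using \<tau>_le by auto
        show "(\<lambda>n. \<rho> \<omega> + 1 / real (Suc n)) \<longlonglongrightarrow> \<rho> \<omega>"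
          using tendsto_add[OF tendsto_const LIMSEQ_inverse_real_of_nat, of "\<rho> \<omega>"] by (simp add: inverse_eq_divide)
      qed simp
    qed
    ultimately show "(\<lambda>n. Y (\<tau> n \<omega>) \<omega>) \<longlonglongrightarrow> Y (\<rho> \<omega>) \<omega>"
      by (rule filterlim_compose)
  qed
  then have W_eq: "AE \<omega> in M. Y (\<rho> \<omega>) \<omega> = W \<omega>"
    by eventually_elim (simp add: W_def limI)
  have lim: "AE \<omega> in M. (\<lambda>n. Y (\<tau> n \<omega>) \<omega>) \<longlonglongrightarrow> W \<omega>"
    using conv W_eq by eventually_elim simp
  have YT: "integrable M (Y T)" using Y b by (simp add: martingale_def T_def)
  note L = integral_tendsto_of_excess_bound[OF st(1) YT st(3) W lim]
  have "integrable M W" by (rule L) auto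
  moreover have "(\<lambda>n. \<integral>\<omega>. Y (\<tau> n \<omega>) \<omega> \<partial>M) \<longlonglongrightarrow> (\<integral>\<omega>. W \<omega> \<partial>M)" by (rule L) auto
  then have "(\<integral>\<omega>. W \<omega> \<partial>M) = (\<integral>\<omega>. Y T \<omega> \<partial>M)"
    using st(2) by (simp add: LIMSEQ_const_iff)
  moreover have "(\<integral>\<omega>. Y T \<omega> \<partial>M) = (\<integral>\<omega>. Y 0 \<omega> \<partial>M)"
  proof -
    have "space M \<in> sets (F 0)" using sub[of 0] sets.top[of "F 0"] by (simp add: subalgebra_def)
    from martingale_integral_indicator[where F=F, OF M sub Y order_refl _ this, of T] b
    have "(\<integral>\<omega>. indicator (space M) \<omega> * Y T \<omega> \<partial>M) = (\<integral>\<omega>. indicator (space M) \<omega> * Y 0 \<omega> \<partial>M)"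
      by (simp add: T_def)
    then show ?thesis by (simp cong: Bochner_Integration.integral_cong)
  qed
  ultimately show thesis using that W_eq by simp
qed

section \<open>Visits of a Markov process to a set\<close>

lemma space_natural_filtration [simp]: "space (natural_filtration M X t) = space M"
  unfolding natural_filtration_def by (rule space_measure_of) auto

lemma sets_natural_filtration:
  "sets (natural_filtration M X t) =
     sigma_sets (space M) {X s -` A \<inter> space M | s A. 0 \<le> s \<and> s \<le> t \<and> A \<in> sets borel}"
  unfolding natural_filtration_def by (rule sets_measure_of) auto

lemma sets_natural_filtration_mono:
  "s \<le> t \<Longrightarrow> sets (natural_filtration M X s) \<subseteq> sets (natural_filtration M X t)"
  unfolding sets_natural_filtration by (rule sigma_sets_mono') (auto intro: order_trans)

lemma (in markov_process) space_P: "space (P x) = space M"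
  using sets_P by (rule sets_eq_imp_space_eq)

lemma (in markov_process) subalgebra_natural_filtration:
  "subalgebra (P x) (natural_filtration M X t)"
proof -
  have "sets (natural_filtration M X t) \<subseteq> sets M"
    unfolding sets_natural_filtration
    by (rule sets.sigma_sets_subset) (auto intro: measurable_sets measurable_X)
  then show ?thesis by (simp add: subalgebra_def space_P sets_P)
qed

lemma (in markov_process) prob_space_K: "0 \<le> t \<Longrightarrow> prob_space (K t x)"
  using transition_function measurable_space[of "K t" borel "prob_algebra borel" x]
  by (auto simp: transition_function_def space_prob_algebra)

text \<open>Conditionally on the past up to \<open>s\<close>, the chance of being in
  \<open>A\<close> at time \<open>s + t\<close> is at least \<open>c\<close>, from wherever the
  process is at time \<open>s\<close>. This is integrated over the past event
  \<open>B\<close>.\<close>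

lemma (in markov_process) measure_Int_ge:
  assumes "0 \<le> s" "0 \<le> t" and A: "A \<in> sets borel" and B: "B \<in> sets (natural_filtration M X s)"
    and c: "\<And>y. c \<le> measure (K t y) A"
  shows "c * measure (P x) B \<le> measure (P x) (B \<inter> {\<omega> \<in> space M. X (s + t) \<omega> \<in> A})"
proof -
  let ?F = "natural_filtration M X s" and ?f = "\<lambda>\<omega>. indicator A (X (s + t) \<omega>) :: real"
  interpret prob_space "P x" by (rule prob_space_P)
  interpret finite_measure_subalgebra "P x" ?F
    using subalgebra_natural_filtration by unfold_locales
  have B': "B \<in> sets (P x)" using B subalgebra_natural_filtration by (auto simp: subalgebra_def)
  have X [measurable]: "X (s + t) \<in> borel_measurable (P x)"
    using measurable_X[of "s + t"] assms(1,2) by (simp add: measurable_cong_sets[OF sets_P refl])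
  note A [measurable]
  have f: "integrable (P x) ?f"
    by (rule integrable_const_bound[of _ 1]) auto
  have "AE \<omega> in P x. c \<le> real_cond_exp (P x) ?F ?f \<omega>"
    using markov_property[OF assms(1-3), of x] by eventually_elim (simp add: c)
  then have "(\<integral>\<omega>. indicator B \<omega> * c \<partial>P x) \<le> (\<integral>\<omega>. indicator B \<omega> * real_cond_exp (P x) ?F ?f \<omega> \<partial>P x)"
  proof (intro integral_mono_AE)
    show "integrable (P x) (\<lambda>\<omega>. indicator B \<omega> * c)"
      using integrable_mult_indicator[OF B', of "\<lambda>_. c"] by simp
    show "integrable (P x) (\<lambda>\<omega>. indicator B \<omega> * real_cond_exp (P x) ?F ?f \<omega>)"
      using integrable_mult_indicator[OF B' real_cond_exp_int(1)[OF f]] by simp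
  qed (auto elim!: eventually_mono simp: indicator_def)
  also have "\<dots> = (\<integral>\<omega>. indicator B \<omega> * ?f \<omega> \<partial>P x)"
    using real_cond_exp_intA[OF f B] by (simp add: set_lebesgue_integral_def)
  also have "\<dots> = (\<integral>\<omega>. indicator (B \<inter> {\<omega> \<in> space M. X (s + t) \<omega> \<in> A}) \<omega> \<partial>P x)"
    by (intro Bochner_Integration.integral_cong) (auto simp: indicator_def space_P)
  finally show ?thesis using B' sets.sets_into_space[OF B']
    by (simp add: space_P Int_absorb2 Int_assoc inf.coboundedI1 mult.commute)
qed

text \<open>Clamping the time argument to the interval makes the map total in time, so that it lives
  on a product with the whole real line. Such products are what the measurability of sections and
  Fubini's theorem work with.\<close>

lemma progressively_measurable_clamp:
  assumes "progressively_measurable F Y" "0 \<le> t"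
  shows "(\<lambda>(\<omega>, s). Y (max 0 (min s t)) \<omega>) \<in> F t \<Otimes>\<^sub>M borel \<rightarrow>\<^sub>M borel"
proof -
  have Y: "(\<lambda>(s, \<omega>). Y s \<omega>) \<in> restrict_space borel {0..t} \<Otimes>\<^sub>M F t \<rightarrow>\<^sub>M borel"
    using assms by (auto simp: progressively_measurable_def)
  have "(\<lambda>p. (max 0 (min (snd p) t), fst p)) \<in> F t \<Otimes>\<^sub>M borel \<rightarrow>\<^sub>M restrict_space borel {0..t} \<Otimes>\<^sub>M F t"
    using assms(2) by (intro measurable_Pair measurable_restrict_space2 measurable_fst) auto
  from measurable_compose[OF this Y] show ?thesis
    by (simp add: case_prod_beta')
qed

text \<open>Positive time in \<open>H\<close> takes the place of a visit to \<open>H\<close>: its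
  measurability at time \<open>t\<close> follows from progressive measurability by taking sections,
  whereas a visit is an uncountable union of events. Since \<open>emeasure\<close> is
  \<open>0\<close> on non-measurable sets, pathwise facts about it carry a measurability
  premise.\<close>

definition occupation :: "'a set \<Rightarrow> (real \<Rightarrow> 'a) \<Rightarrow> real \<Rightarrow> ennreal" where
  "occupation H p t = emeasure lborel {s \<in> {0..t}. p s \<in> H}"

lemma progressively_measurable_visits:
  assumes prog: "progressively_measurable F Y" and H: "H \<in> sets borel" and a: "0 \<le> a"
  shows "{p \<in> space (F t \<Otimes>\<^sub>M borel). snd p \<in> {a..t} \<and> Y (snd p) (fst p) \<in> H} \<in> sets (F t \<Otimes>\<^sub>M borel)"
proof (cases "0 \<le> t")
  case True
  note [measurable] = progressively_measurable_clamp[OF prog True] H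
  have "{p \<in> space (F t \<Otimes>\<^sub>M borel). snd p \<in> {a..t} \<and> Y (snd p) (fst p) \<in> H}
     = {p \<in> space (F t \<Otimes>\<^sub>M borel). snd p \<in> {a..t} \<and> (\<lambda>(\<omega>, s). Y (max 0 (min s t)) \<omega>) p \<in> H}"
    using a by (auto simp: min_absorb1 max_absorb2)
  also have "\<dots> \<in> sets (F t \<Otimes>\<^sub>M borel)" by measurable
  finally show ?thesis .
qed (use a in \<open>auto intro: sets.empty_sets simp: atLeastatMost_empty\<close>)

lemma progressively_measurable_visits_path:
  assumes "progressively_measurable F Y" "H \<in> sets borel" "0 \<le> a" and \<omega>: "\<omega> \<in> space (F t)"
  shows "{s \<in> {a..t}. Y s \<omega> \<in> H} \<in> sets borel"
proof -
  have "{s \<in> {a..t}. Y s \<omega> \<in> H}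
    = Pair \<omega> -` {p \<in> space (F t \<Otimes>\<^sub>M borel). snd p \<in> {a..t} \<and> Y (snd p) (fst p) \<in> H}"
    using \<omega> by (auto simp: space_pair_measure)
  then show ?thesis
    using sets_Pair1[OF progressively_measurable_visits[OF assms(1-3)]] by simp
qed

lemma measurable_occupation:
  assumes "progressively_measurable F Y" "H \<in> sets borel" "0 \<le> t"
  shows "(\<lambda>\<omega>. occupation H (\<lambda>s. Y s \<omega>) t) \<in> borel_measurable (F t)"
proof -
  let ?Q = "{p \<in> space (F t \<Otimes>\<^sub>M borel). snd p \<in> {0..t} \<and> Y (snd p) (fst p) \<in> H}"
  have "?Q \<in> sets (F t \<Otimes>\<^sub>M lborel)"
    using progressively_measurable_visits[OF assms(1,2) order_refl, of t]
    by (simp add: sets_pair_measure_cong[OF refl sets_lborel])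
  then have "(\<lambda>\<omega>. emeasure lborel (Pair \<omega> -` ?Q)) \<in> borel_measurable (F t)"
    by (rule lborel.measurable_emeasure_Pair)
  moreover have "occupation H (\<lambda>s. Y s \<omega>) t = emeasure lborel (Pair \<omega> -` ?Q)" if "\<omega> \<in> space (F t)" for \<omega>
    using that unfolding occupation_def by (intro arg_cong[where f="emeasure lborel"]) (auto simp: space_pair_measure)
  ultimately show ?thesis by (subst measurable_cong)
qed

text \<open>Time is cut into blocks of length \<open>r + 1\<close>. After the first \<open>r\<close>
  units of a block the process is in \<open>H\<close> with probability at least \<open>c\<close>
  whatever happened before, so on the event \<open>?N s\<close> of no occupation so far the last
  unit of the block has expected occupation at least \<open>c * prob (?N s)\<close>. This occupation
  is at most \<open>1\<close> and vanishes on \<open>?N t\<close>. Hence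
  \<open>c * prob (?N s) \<le> prob (?N s) - prob (?N t)\<close>, and each block contributes a
  factor \<open>1 - c\<close>.\<close>

lemma (in markov_process) unvisited_measure_decay:
  assumes prog: "progressively_measurable (natural_filtration M X) X" and H: "H \<in> sets borel"
    and r: "0 \<le> r" and c: "0 \<le> c" "\<And>y t. r \<le> t \<Longrightarrow> c \<le> measure (K t y) H"
  shows "measure (P x) {\<omega> \<in> space M. occupation H (\<lambda>s. X s \<omega>) (real n * (r + 1)) = 0} \<le> (1 - c) ^ n"
proof (induction n)
  case 0
  interpret prob_space "P x" by (rule prob_space_P)
  show ?case by simp
next
  case (Suc n)
  interpret prob_space "P x" by (rule prob_space_P)
  define s where "s = real n * (r + 1)"
  define t where "t = s + r + 1"
  have st: "0 \<le> s" "0 \<le> t" "s \<le> t" using r by (auto simp: s_def t_def)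
  have t_eq: "real (Suc n) * (r + 1) = t" by (simp add: s_def t_def algebra_simps)
  let ?F = "natural_filtration M X"
  let ?N = "\<lambda>t. {\<omega> \<in> space M. occupation H (\<lambda>s. X s \<omega>) t = 0}"
  have F_P: "sets (?F u) \<subseteq> sets (P x)" for u
    using subalgebra_natural_filtration[of x u] by (simp add: subalgebra_def)
  have N_F: "?N u \<in> sets (?F u)" if "0 \<le> u" for u
  proof -
    note measurable_occupation[OF prog H that, measurable]
    have "{\<omega> \<in> space (?F u). occupation H (\<lambda>s. X s \<omega>) u = 0} \<in> sets (?F u)" by measurable
    then show ?thesis by simp
  qed
  have N_P [measurable]: "?N s \<in> sets (P x)" "?N t \<in> sets (P x)"
    using N_F st F_P by blast+
  have visits: "{q \<in> {a..u}. X q \<omega> \<in> H} \<in> sets borel" if "\<omega> \<in> space M" "0 \<le> a" for a u \<omega>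
    using progressively_measurable_visits_path[OF prog H that(2), of \<omega> u] that by simp
  have sub: "?N t \<subseteq> ?N s"
  proof safe
    fix \<omega> assume "\<omega> \<in> space M" and 0: "occupation H (\<lambda>s. X s \<omega>) t = 0"
    then have "occupation H (\<lambda>s. X s \<omega>) s \<le> occupation H (\<lambda>s. X s \<omega>) t"
      unfolding occupation_def using st visits by (intro emeasure_mono) auto
    with 0 show "occupation H (\<lambda>s. X s \<omega>) s = 0" by simp
  qed
  define Q where "Q = {p \<in> space (?F t \<Otimes>\<^sub>M borel). snd p \<in> {s + r..t} \<and> X (snd p) (fst p) \<in> H}"
  have "Q \<in> sets (?F t \<Otimes>\<^sub>M borel)"
    unfolding Q_def using st r by (intro progressively_measurable_visits prog H) auto
  moreover have "(\<lambda>p. (fst p, snd p)) \<in> P x \<Otimes>\<^sub>M lborel \<rightarrow>\<^sub>M ?F t \<Otimes>\<^sub>M borel"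
    using measurable_from_subalg[OF subalgebra_natural_filtration measurable_ident_sets[OF refl]]
    by (intro measurable_Pair measurable_compose[OF measurable_fst]) auto
  ultimately have "(\<lambda>p. (fst p, snd p)) -` Q \<inter> space (P x \<Otimes>\<^sub>M lborel) \<in> sets (P x \<Otimes>\<^sub>M lborel)"
    by (rule measurable_sets[rotated])
  moreover have "(\<lambda>p. (fst p, snd p)) -` Q \<inter> space (P x \<Otimes>\<^sub>M lborel) = Q"
    by (auto simp: Q_def space_pair_measure space_P)
  ultimately have Q [measurable]: "Q \<in> sets (P x \<Otimes>\<^sub>M lborel)" by simp
  \<comment> \<open>The window \<open>{s + r..t}\<close> has length \<open>1\<close>, so the
    constant equals its integral over the window.\<close>
  have "ennreal (c * prob (?N s)) = (\<integral>\<^sup>+q. ennreal (c * prob (?N s)) * indicator {s + r..t} q \<partial>lborel)"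
    using st by (simp add: nn_integral_cmult_indicator t_def)
  also have "\<dots> \<le> (\<integral>\<^sup>+q. (\<integral>\<^sup>+\<omega>. indicator (?N s) \<omega> * indicator Q (\<omega>, q) \<partial>P x) \<partial>lborel)"
  proof (rule nn_integral_mono)
    fix q :: real
    show "ennreal (c * prob (?N s)) * indicator {s + r..t} q \<le> (\<integral>\<^sup>+\<omega>. indicator (?N s) \<omega> * indicator Q (\<omega>, q) \<partial>P x)"
    proof (cases "q \<in> {s + r..t}")
      case True
      let ?B = "?N s \<inter> {\<omega> \<in> space M. X (s + (q - s)) \<omega> \<in> H}"
      have "{\<omega> \<in> space M. X q \<omega> \<in> H} \<in> sets M"
        using measurable_sets[OF measurable_X[of q] H] True st r by (simp add: vimage_def Int_def conj_commute)
      then have B: "?B \<in> sets (P x)" using N_P(1) by (intro sets.Int) (auto simp: sets_P)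
      have "c * prob (?N s) \<le> prob ?B"
        using True r st N_F[of s] c(2) by (intro measure_Int_ge H) auto
      then have "ennreal (c * prob (?N s)) \<le> emeasure (P x) ?B"
        by (simp add: emeasure_eq_measure ennreal_leI)
      also have "\<dots> = (\<integral>\<^sup>+\<omega>. indicator ?B \<omega> \<partial>P x)" using B by simp
      also have "\<dots> = (\<integral>\<^sup>+\<omega>. indicator (?N s) \<omega> * indicator Q (\<omega>, q) \<partial>P x)"
        using True by (intro nn_integral_cong) (auto simp: Q_def indicator_def space_pair_measure)
      finally show ?thesis using True by simp
    qed simp
  qed
  also have "\<dots> = (\<integral>\<^sup>+\<omega>. (\<integral>\<^sup>+q. indicator (?N s) \<omega> * indicator Q (\<omega>, q) \<partial>lborel) \<partial>P x)"
  proof -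
    interpret pair_sigma_finite "P x" lborel ..
    show ?thesis by (rule Fubini') measurable
  qed
  also have "\<dots> \<le> (\<integral>\<^sup>+\<omega>. indicator (?N s - ?N t) \<omega> \<partial>P x)"
  proof (rule nn_integral_mono)
    fix \<omega> assume "\<omega> \<in> space (P x)"
    then have \<omega>: "\<omega> \<in> space M" by (simp add: space_P)
    have "(\<integral>\<^sup>+q. indicator (?N s) \<omega> * indicator Q (\<omega>, q) \<partial>lborel)
        = (\<integral>\<^sup>+q. indicator (?N s) \<omega> * indicator {q \<in> {s + r..t}. X q \<omega> \<in> H} q \<partial>lborel)"
      using \<omega> by (intro nn_integral_cong) (auto simp: Q_def indicator_def space_pair_measure)
    also have "\<dots> = indicator (?N s) \<omega> * emeasure lborel {q \<in> {s + r..t}. X q \<omega> \<in> H}"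
      using visits[OF \<omega>, of "s + r" t] st r by (intro nn_integral_cmult_indicator) auto
    also have "\<dots> \<le> indicator (?N s - ?N t) \<omega>"
    proof (cases "\<omega> \<in> ?N t")
      case True
      have "emeasure lborel {q \<in> {s + r..t}. X q \<omega> \<in> H} \<le> occupation H (\<lambda>s. X s \<omega>) t"
        unfolding occupation_def using st r visits[OF \<omega>] by (intro emeasure_mono) auto
      then show ?thesis using True by simp
    next
      case False
      have "emeasure lborel {q \<in> {s + r..t}. X q \<omega> \<in> H} \<le> emeasure lborel {s + r..t}"
        by (intro emeasure_mono) auto
      also have "\<dots> = 1" by (simp add: t_def)
      finally show ?thesis using False by (auto simp: indicator_def)
    qed
    finally show "(\<integral>\<^sup>+q. indicator (?N s) \<omega> * indicator Q (\<omega>, q) \<partial>lborel) \<le> indicator (?N s - ?N t) \<omega>" .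
  qed
  also have "\<dots> = ennreal (prob (?N s) - prob (?N t))"
    using sub by (simp add: emeasure_eq_measure finite_measure_Diff)
  finally have "c * prob (?N s) \<le> prob (?N s) - prob (?N t)"
    using sub by (subst (asm) ennreal_le_iff) (auto intro: finite_measure_mono)
  then have "prob (?N t) \<le> (1 - c) * prob (?N s)" by (simp add: algebra_simps)
  also have "\<dots> \<le> (1 - c) * (1 - c) ^ n"
  proof (rule mult_left_mono)
    show "prob (?N s) \<le> (1 - c) ^ n" using Suc.IH by (simp add: s_def)
    interpret K: prob_space "K r x" using r by (rule prob_space_K)
    show "0 \<le> 1 - c" using c(2)[of r x] K.prob_le_1[of H] by linarith
  qed
  finally show ?case unfolding t_eq by simp
qed

section \<open>Occupation along a single path\<close>

lemma occupation_mono: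
  assumes "\<And>t. {s \<in> {0..t}. p s \<in> H} \<in> sets borel" "s \<le> t"
  shows "occupation H p s \<le> occupation H p t"
  unfolding occupation_def using assms by (intro emeasure_mono) auto

lemma occupation_le_add:
  assumes meas: "\<And>t. {s \<in> {0..t}. p s \<in> H} \<in> sets borel" and "s \<le> t"
  shows "occupation H p t \<le> occupation H p s + ennreal (t - s)"
proof -
  have "occupation H p t \<le> emeasure lborel ({q \<in> {0..s}. p q \<in> H} \<union> {s..t})"
    unfolding occupation_def using meas by (intro emeasure_mono) auto
  also have "\<dots> \<le> occupation H p s + emeasure lborel {s..t}"
    unfolding occupation_def using meas by (intro emeasure_subadditive) auto
  finally show ?thesis using \<open>s \<le> t\<close> by simp
qed

lemma AE_not_visited:
  assumes meas: "{s \<in> {0..t}. p s \<in> H} \<in> sets borel" and "occupation H p t = 0"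
  shows "AE s in lborel. s \<in> {0..t} \<longrightarrow> p s \<notin> H"
  by (rule AE_I[of _ _ "{s \<in> {0..t}. p s \<in> H}"]) (use assms in \<open>auto simp: occupation_def\<close>)

text \<open>This replaces the hitting time of \<open>H\<close>, which need not be a stopping time of the raw
  filtration. The events \<open>last_unvisited H p k < s\<close> depend only on \<open>p\<close> up to \<open>s\<close>, almost every
  earlier time is spent outside \<open>H\<close>, and a right-continuous path is in the closed set \<open>H\<close> at
  this time if it is less than \<open>k\<close>.\<close>

definition last_unvisited :: "'a set \<Rightarrow> (real \<Rightarrow> 'a) \<Rightarrow> real \<Rightarrow> real" where
  "last_unvisited H p k = Sup {t \<in> {0..k}. occupation H p t = 0}"

text \<open>A single instant is a null set, so \<open>0\<close> belongs to the set whose supremum is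
  taken. The supremum is attained because from a nearly maximal \<open>t\<close> up to it the
  occupation grows by at most the elapsed time.\<close>

lemma last_unvisited_props:
  assumes meas: "\<And>t. {s \<in> {0..t}. p s \<in> H} \<in> sets borel" and k: "0 \<le> k"
  shows "0 \<le> last_unvisited H p k" "last_unvisited H p k \<le> k"
    and "occupation H p (last_unvisited H p k) = 0"
proof -
  let ?S = "{t \<in> {0..k}. occupation H p t = 0}" and ?\<sigma> = "last_unvisited H p k"
  have "occupation H p 0 \<le> emeasure lborel {0::real}"
    unfolding occupation_def by (intro emeasure_mono) auto
  then have 0: "0 \<in> ?S" using k by simp
  have bdd: "bdd_above ?S" by (rule bdd_aboveI[of _ k]) auto
  show "0 \<le> ?\<sigma>" unfolding last_unvisited_def using 0 bdd by (rule cSup_upper)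
  show "?\<sigma> \<le> k" unfolding last_unvisited_def using 0 by (intro cSup_least) auto
  show "occupation H p ?\<sigma> = 0"
  proof -
    have "occupation H p ?\<sigma> \<le> 0 + ennreal e" if e: "0 < e" for e
    proof -
      have "?\<sigma> - e < Sup ?S" using e by (simp add: last_unvisited_def)
      then obtain t where t: "t \<in> ?S" "?\<sigma> - e < t"
        using less_cSup_iff[OF _ bdd] 0 by blast
      have "t \<le> ?\<sigma>" unfolding last_unvisited_def using t(1) bdd by (rule cSup_upper)
      from occupation_le_add[OF meas this] t(1) have "occupation H p ?\<sigma> \<le> ennreal (?\<sigma> - t)" by simp
      also have "\<dots> \<le> ennreal e" using t(2) by (intro ennreal_leI) simp
      finally show ?thesis by simp
    qed
    then have "occupation H p ?\<sigma> \<le> 0" by (rule ennreal_le_epsilon)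
    then show ?thesis by simp
  qed
qed

text \<open>Occupation is monotone in time and the supremum is attained, so the times of zero
  occupation up to \<open>k\<close> fill exactly the interval from \<open>0\<close> to
  \<open>last_unvisited H p k\<close>. The right-hand side concerns the path up to \<open>s\<close>
  only, which is what \<open>optional_stopping\<close> asks of a random time.\<close>

lemma last_unvisited_less_iff:
  assumes meas: "\<And>t. {s \<in> {0..t}. p s \<in> H} \<in> sets borel" and k: "0 \<le> k" and s: "0 \<le> s" "s \<le> k"
  shows "last_unvisited H p k < s \<longleftrightarrow> occupation H p s \<noteq> 0"
proof
  assume *: "last_unvisited H p k < s"
  show "occupation H p s \<noteq> 0"
  proof
    assume "occupation H p s = 0"
    then have "s \<le> last_unvisited H p k"
      unfolding last_unvisited_def using s by (intro cSup_upper bdd_aboveI[of _ k]) auto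
    then show False using * by simp
  qed
next
  assume *: "occupation H p s \<noteq> 0"
  show "last_unvisited H p k < s"
  proof (rule ccontr)
    assume "\<not> last_unvisited H p k < s"
    then have "occupation H p s \<le> occupation H p (last_unvisited H p k)"
      by (intro occupation_mono meas) auto
    then show False using * last_unvisited_props(3)[OF meas k] by simp
  qed
qed

text \<open>Otherwise the path, by right-continuity, would stay in the open complement of
  \<open>H\<close> for a short while after this time, the occupation would remain zero beyond it,
  and it would not be the supremum. Being less than \<open>k\<close> leaves room for such later
  times.\<close>

lemma last_unvisited_mem:
  fixes p :: "real \<Rightarrow> 'a::topological_space"
  assumes meas: "\<And>t. {s \<in> {0..t}. p s \<in> H} \<in> sets borel" and k: "0 \<le> k"
    and less: "last_unvisited H p k < k" and rc: "right_continuous_path p" and H: "closed H"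
  shows "p (last_unvisited H p k) \<in> H"
proof (rule ccontr)
  let ?\<sigma> = "last_unvisited H p k"
  note props = last_unvisited_props[OF meas k]
  assume "p ?\<sigma> \<notin> H"
  then have nh: "p ?\<sigma> \<in> - H" by simp
  have "(p \<longlongrightarrow> p ?\<sigma>) (at_right ?\<sigma>)"
    using rc props by (auto simp: right_continuous_path_def continuous_within)
  then have "\<forall>\<^sub>F t in at_right ?\<sigma>. p t \<in> - H"
    using nh H by (intro topological_tendstoD) auto
  then obtain b where b: "b > ?\<sigma>" "\<And>t. ?\<sigma> < t \<Longrightarrow> t < b \<Longrightarrow> p t \<notin> H"
    unfolding eventually_at_right_field by auto
  \<comment> \<open>The midpoint lies before \<open>b\<close>, where the path is still off
    \<open>H\<close>, and before \<open>k\<close>, where it competes in the supremum.\<close>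
  define t where "t = (?\<sigma> + min b k) / 2"
  have t: "?\<sigma> < t" "t < b" "t < k" using b less by (auto simp: t_def)
  have "{s \<in> {0..t}. p s \<in> H} = {s \<in> {0..?\<sigma>}. p s \<in> H}"
  proof -
    have "q \<le> ?\<sigma>" if "q \<le> t" "p q \<in> H" for q
      using b(2)[of q] that t by linarith
    then show ?thesis using t by auto
  qed
  then have "occupation H p t = 0" using props by (simp add: occupation_def)
  then show False
    using last_unvisited_less_iff[OF meas k, of t] t props by auto
qed

section \<open>The drift estimate\<close>

lemma right_continuous_path_stop:
  assumes p: "right_continuous_path p" and T: "0 \<le> T"
  shows "right_continuous_path (\<lambda>t. p (min t T))"
  unfolding right_continuous_path_def
proof (intro allI impI)
  fix t :: real assume t: "0 \<le> t"
  show "continuous (at_right t) (\<lambda>t. p (min t T))"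
  proof (cases "t < T")
    case True
    have "\<forall>\<^sub>F s in at_right t. p (min s T) = p s"
      using True unfolding eventually_at_right_field by (intro exI[of _ T]) auto
    moreover have "(p \<longlongrightarrow> p t) (at_right t)"
      using p t by (auto simp: right_continuous_path_def continuous_within)
    ultimately show ?thesis
      using True by (simp add: continuous_within tendsto_cong)
  next
    case False
    have "\<forall>\<^sub>F s in at_right t. p (min s T) = p (min t T)"
      using False unfolding eventually_at_right_field by (intro exI[of _ "t + 1"]) auto
    then show ?thesis
      unfolding continuous_within by (rule tendsto_eventually)
  qed
qed

text \<open>The times \<open>T k\<close> come first and \<open>\<rho>\<close> is quantified
  afterwards, because the \<open>\<rho>\<close> used below is itself a minimum involving the
  localizing times of two functions. As \<open>\<rho> \<le> T k\<close>, the localized process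
  agrees at \<open>\<rho>\<close> with the original one; the mean is \<open>0\<close> since the
  process starts from \<open>0\<close>. \<open>W\<close> is an integrable version of its value at
  \<open>\<rho>\<close>.\<close>

lemma (in markov_process) generator_optional_stopping:
  assumes gp: "generator_pair M P X f g"
  obtains T :: "nat \<Rightarrow> 'w \<Rightarrow> real"
  where "\<forall>k. stopping_time (natural_filtration M X) (T k)"
    and "\<forall>k. \<forall>\<omega>\<in>space M. 0 \<le> T k \<omega>"
    and "AE \<omega> in P x. filterlim (\<lambda>k. T k \<omega>) at_top sequentially"
    and "\<forall>k b \<rho>. (\<forall>\<omega>\<in>space M. 0 \<le> \<rho> \<omega> \<and> \<rho> \<omega> \<le> b \<and> \<rho> \<omega> \<le> T k \<omega>) \<longrightarrow>
      (\<forall>s. {\<omega> \<in> space M. \<rho> \<omega> < s} \<in> sets (natural_filtration M X s)) \<longrightarrow>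
      (\<exists>W. integrable (P x) W \<and>
        (AE \<omega> in P x. f (X (\<rho> \<omega>) \<omega>) - f x - (LINT s:{0..\<rho> \<omega>}|lborel. g (X s \<omega>)) = W \<omega>) \<and>
        (\<integral>\<omega>. W \<omega> \<partial>P x) = 0)"
proof -
  let ?F = "natural_filtration M X"
  define N where "N t \<omega> = f (X t \<omega>) - f (X 0 \<omega>) - (LINT s:{0..t}|lborel. g (X s \<omega>))" for t \<omega>
  have "local_martingale (P x) ?F N"
    using gp unfolding generator_pair_def N_def by blast
  then obtain T :: "nat \<Rightarrow> 'w \<Rightarrow> real" where rc: "AE \<omega> in P x. right_continuous_path (\<lambda>t. N t \<omega>)"
    and T: "\<And>k. stopping_time ?F (T k)" "\<And>k \<omega>. \<omega> \<in> space M \<Longrightarrow> 0 \<le> T k \<omega>"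
    and lim: "AE \<omega> in P x. incseq (\<lambda>k. T k \<omega>) \<and> filterlim (\<lambda>k. T k \<omega>) at_top sequentially"
    and mart: "\<And>k. martingale (P x) ?F (\<lambda>t \<omega>. N (min t (T k \<omega>)) \<omega>)"
    unfolding local_martingale_def space_P by blast
  show thesis
  proof (rule that[of T])
    show "AE \<omega> in P x. filterlim (\<lambda>k. T k \<omega>) at_top sequentially"
      using lim by eventually_elim simp
  next
    show "\<forall>k b \<rho>. (\<forall>\<omega>\<in>space M. 0 \<le> \<rho> \<omega> \<and> \<rho> \<omega> \<le> b \<and> \<rho> \<omega> \<le> T k \<omega>) \<longrightarrow>
      (\<forall>s. {\<omega> \<in> space M. \<rho> \<omega> < s} \<in> sets (?F s)) \<longrightarrow>
      (\<exists>W. integrable (P x) W \<and>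
        (AE \<omega> in P x. f (X (\<rho> \<omega>) \<omega>) - f x - (LINT s:{0..\<rho> \<omega>}|lborel. g (X s \<omega>)) = W \<omega>) \<and>
        (\<integral>\<omega>. W \<omega> \<partial>P x) = 0)"
    proof (intro allI impI)
      fix k b and \<rho> :: "'w \<Rightarrow> real"
      assume "\<forall>\<omega>\<in>space M. 0 \<le> \<rho> \<omega> \<and> \<rho> \<omega> \<le> b \<and> \<rho> \<omega> \<le> T k \<omega>"
        and "\<forall>s. {\<omega> \<in> space M. \<rho> \<omega> < s} \<in> sets (?F s)"
      then have \<rho>: "\<And>\<omega>. \<omega> \<in> space M \<Longrightarrow> 0 \<le> \<rho> \<omega> \<and> \<rho> \<omega> \<le> b \<and> \<rho> \<omega> \<le> T k \<omega>"
        and opt: "\<And>s. {\<omega> \<in> space M. \<rho> \<omega> < s} \<in> sets (?F s)" by blast+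
      have rc': "AE \<omega> in P x. right_continuous_path (\<lambda>t. N (min t (T k \<omega>)) \<omega>)"
        using rc AE_space
      proof eventually_elim
        case (elim \<omega>)
        then show ?case using T(2) by (intro right_continuous_path_stop[of "\<lambda>t. N t \<omega>"]) (auto simp: space_P)
      qed
      obtain W where W: "integrable (P x) W" "AE \<omega> in P x. N (min (\<rho> \<omega>) (T k \<omega>)) \<omega> = W \<omega>"
        "(\<integral>\<omega>. W \<omega> \<partial>P x) = (\<integral>\<omega>. N (min 0 (T k \<omega>)) \<omega> \<partial>P x)"
        using optional_stopping[OF prob_space_P subalgebra_natural_filtration sets_natural_filtration_mono mart rc', of \<rho> b]
          \<rho> opt by (auto simp: space_P)
      have N0: "N 0 \<omega> = 0" for \<omega>
      proof -
        have "AE s in lborel. s \<noteq> (0::real)" by (rule AE_lborel_singleton)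
        then have "(LINT s:{0..0}|lborel. g (X s \<omega>)) = 0"
          unfolding set_lebesgue_integral_def by (intro integral_eq_zero_AE) (auto elim!: eventually_mono)
        then show ?thesis by (simp add: N_def)
      qed
      have "(\<integral>\<omega>. N (min 0 (T k \<omega>)) \<omega> \<partial>P x) = (\<integral>\<omega>. 0 \<partial>P x)"
        using T(2) N0 by (intro Bochner_Integration.integral_cong) (auto simp: space_P min_absorb1)
      then have "(\<integral>\<omega>. W \<omega> \<partial>P x) = 0" using W(3) by simp
      moreover have "AE \<omega> in P x. f (X (\<rho> \<omega>) \<omega>) - f x - (LINT s:{0..\<rho> \<omega>}|lborel. g (X s \<omega>)) = W \<omega>"
        using W(2) start[of x] AE_space
      proof eventually_elim
        case (elim \<omega>)
        then show ?case using \<rho>[of \<omega>] by (simp add: N_def space_P min_absorb1)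
      qed
      ultimately show "\<exists>W. integrable (P x) W \<and>
          (AE \<omega> in P x. f (X (\<rho> \<omega>) \<omega>) - f x - (LINT s:{0..\<rho> \<omega>}|lborel. g (X s \<omega>)) = W \<omega>) \<and>
          (\<integral>\<omega>. W \<omega> \<partial>P x) = 0"
        using W(1) by blast
    qed
  qed (use T in auto)
qed

text \<open>The term \<open>(r + 1) / c\<close> is the sum of the geometric series that controls the
  mean of the stopping time, in blocks of length \<open>r + 1\<close>. \<open>C\<close> is absent
  from the conclusion because it is paid only on the event \<open>B k\<close> of stopping outside
  \<open>H\<close>, whose probability tends to \<open>0\<close>. This allows \<open>e\<close> to be
  sent to \<open>0\<close> later although \<open>C\<close> is chosen depending on it.\<close>

lemma (in markov_process) lyapunov_bound:
  assumes prog: "progressively_measurable (natural_filtration M X) X"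
    and rc: "\<And>\<omega>. \<omega> \<in> space M \<Longrightarrow> right_continuous_path (\<lambda>t. X t \<omega>)"
    and H: "closed H"
    and r: "0 \<le> r" and c: "0 < c" "\<And>y t. r \<le> t \<Longrightarrow> c \<le> measure (K t y) H"
    and u: "generator_pair M P X u Lu" "\<And>y. 0 \<le> u y" "\<And>y. y \<notin> H \<Longrightarrow> - 1 \<le> Lu y"
    and v: "generator_pair M P X v Lv" "\<And>y. 0 \<le> v y" "\<And>y. y \<notin> H \<Longrightarrow> Lv y \<le> 0"
    and h: "0 \<le> h" "\<And>y. y \<in> H \<Longrightarrow> u y \<le> h"
    and e: "0 \<le> e" "0 \<le> C" "\<And>y. u y \<le> e * v y + C"
  shows "u x \<le> h + e * v x + (r + 1) / c"
proof -
  let ?F = "natural_filtration M X"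
  interpret prob_space "P x" by (rule prob_space_P)
  interpret K: prob_space "K r x" using r by (rule prob_space_K)
  have c1: "c \<le> 1" using c(2)[of r x] K.prob_le_1[of H] by linarith
  have H_borel: "H \<in> sets borel" using H by auto
  have F_P: "sets (?F t) \<subseteq> sets (P x)" for t
    using subalgebra_natural_filtration[of x t] by (simp add: subalgebra_def)
  let ?occ = "\<lambda>t \<omega>. occupation H (\<lambda>s. X s \<omega>) t"
  have visits: "{s \<in> {0..t}. X s \<omega> \<in> H} \<in> sets borel" if "\<omega> \<in> space M" for \<omega> t
    using progressively_measurable_visits_path[OF prog H_borel order_refl, of \<omega> t] that by simp
  obtain Tu where Tu': "\<forall>k. stopping_time ?F (Tu k)" "\<forall>k. \<forall>\<omega>\<in>space M. 0 \<le> Tu k \<omega>"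
      "AE \<omega> in P x. filterlim (\<lambda>k. Tu k \<omega>) at_top sequentially"
    and Tu_stop: "\<forall>k b \<rho>. (\<forall>\<omega>\<in>space M. 0 \<le> \<rho> \<omega> \<and> \<rho> \<omega> \<le> b \<and> \<rho> \<omega> \<le> Tu k \<omega>) \<longrightarrow>
      (\<forall>s. {\<omega> \<in> space M. \<rho> \<omega> < s} \<in> sets (?F s)) \<longrightarrow>
      (\<exists>W. integrable (P x) W \<and>
        (AE \<omega> in P x. u (X (\<rho> \<omega>) \<omega>) - u x - (LINT s:{0..\<rho> \<omega>}|lborel. Lu (X s \<omega>)) = W \<omega>) \<and>
        (\<integral>\<omega>. W \<omega> \<partial>P x) = 0)"
    by (rule generator_optional_stopping[OF u(1), of x]) (rule that)
  note Tu = Tu'(1)[rule_format] Tu'(2)[rule_format] Tu'(3)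
  obtain Tv where Tv': "\<forall>k. stopping_time ?F (Tv k)" "\<forall>k. \<forall>\<omega>\<in>space M. 0 \<le> Tv k \<omega>"
      "AE \<omega> in P x. filterlim (\<lambda>k. Tv k \<omega>) at_top sequentially"
    and Tv_stop: "\<forall>k b \<rho>. (\<forall>\<omega>\<in>space M. 0 \<le> \<rho> \<omega> \<and> \<rho> \<omega> \<le> b \<and> \<rho> \<omega> \<le> Tv k \<omega>) \<longrightarrow>
      (\<forall>s. {\<omega> \<in> space M. \<rho> \<omega> < s} \<in> sets (?F s)) \<longrightarrow>
      (\<exists>W. integrable (P x) W \<and>
        (AE \<omega> in P x. v (X (\<rho> \<omega>) \<omega>) - v x - (LINT s:{0..\<rho> \<omega>}|lborel. Lv (X s \<omega>)) = W \<omega>) \<and>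
        (\<integral>\<omega>. W \<omega> \<partial>P x) = 0)"
    by (rule generator_optional_stopping[OF v(1), of x]) (rule that)
  note Tv = Tv'(1)[rule_format] Tv'(2)[rule_format] Tv'(3)
  define \<sigma> where "\<sigma> k \<omega> = last_unvisited H (\<lambda>s. X s \<omega>) (real k)" for k \<omega>
  \<comment> \<open>One time serves both functions, as the estimate for \<open>u\<close> uses the
    mean of \<open>v\<close> at the same time. It is bounded because
    \<open>\<sigma> k \<le> k\<close>.\<close>
  define \<rho> where "\<rho> k \<omega> = min (\<sigma> k \<omega>) (min (Tu k \<omega>) (Tv k \<omega>))" for k \<omega>
  have \<sigma>: "0 \<le> \<sigma> k \<omega>" "\<sigma> k \<omega> \<le> real k" "?occ (\<sigma> k \<omega>) \<omega> = 0" if "\<omega> \<in> space M" for k \<omega>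
    using last_unvisited_props[OF visits[OF that], of "real k"] by (auto simp: \<sigma>_def)
  have \<rho>: "0 \<le> \<rho> k \<omega>" "\<rho> k \<omega> \<le> real k" "\<rho> k \<omega> \<le> Tu k \<omega>" "\<rho> k \<omega> \<le> Tv k \<omega>" "\<rho> k \<omega> \<le> \<sigma> k \<omega>"
    if "\<omega> \<in> space M" for k \<omega>
    using \<sigma>[OF that, of k] Tu(2)[OF that, of k] Tv(2)[OF that, of k] by (auto simp: \<rho>_def)
  have occ_\<rho>: "?occ s \<omega> = 0" if "\<omega> \<in> space M" "s \<le> \<rho> k \<omega>" for k \<omega> s
    using occupation_mono[OF visits[OF that(1)], of s "\<sigma> k \<omega>"] \<sigma>[OF that(1), of k] \<rho>[OF that(1), of k] that(2) by auto
  \<comment> \<open>\<open>stopping_time\<close> provides the events \<open>T \<le> s\<close>; the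
    strict ones, in the form that \<open>optional_stopping\<close> takes, are countable unions of
    earlier such events.\<close>
  have stopping_less: "{\<omega> \<in> space M. T \<omega> < s} \<in> sets (?F s)" if T: "stopping_time ?F T" for T s
  proof -
    have "{\<omega> \<in> space M. T \<omega> < s} = (\<Union>n. {\<omega> \<in> space M. T \<omega> \<le> s - inverse (real (Suc n))})"
    proof (intro set_eqI iffI)
      fix \<omega> assume *: "\<omega> \<in> {\<omega> \<in> space M. T \<omega> < s}"
      then obtain n where "inverse (real (Suc n)) < s - T \<omega>" using reals_Archimedean[of "s - T \<omega>"] by auto
      with * show "\<omega> \<in> (\<Union>n. {\<omega> \<in> space M. T \<omega> \<le> s - inverse (real (Suc n))})" by (auto intro!: exI[of _ n])
    next
      fix \<omega> assume "\<omega> \<in> (\<Union>n. {\<omega> \<in> space M. T \<omega> \<le> s - inverse (real (Suc n))})"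
      then obtain n where "\<omega> \<in> space M" "T \<omega> \<le> s - inverse (real (Suc n))" by auto
      moreover have "0 < inverse (real (Suc n))" by simp
      ultimately have "\<omega> \<in> space M \<and> T \<omega> < s" by linarith
      then show "\<omega> \<in> {\<omega> \<in> space M. T \<omega> < s}" by simp
    qed
    also have "\<dots> \<in> sets (?F s)"
    proof (rule sets.countable_UN, rule image_subsetI)
      fix n
      have "{\<omega> \<in> space M. T \<omega> \<le> s - inverse (real (Suc n))} \<in> sets (?F (s - inverse (real (Suc n))))"
        using stopping_timeD[OF T, of "s - inverse (real (Suc n))"] by (simp add: pred_def)
      then show "{\<omega> \<in> space M. T \<omega> \<le> s - inverse (real (Suc n))} \<in> sets (?F s)"
        using sets_natural_filtration_mono[of "s - inverse (real (Suc n))" s M X] by auto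
    qed
    finally show ?thesis .
  qed
  have \<sigma>_less: "{\<omega> \<in> space M. \<sigma> k \<omega> < s} \<in> sets (?F s)" for k s
  proof -
    consider "s \<le> 0" | "0 < s" "s \<le> real k" | "real k < s" by linarith
    then show ?thesis
    proof cases
      case 1
      have "\<not> \<sigma> k \<omega> < s" if "\<omega> \<in> space M" for \<omega>
        using \<sigma>(1)[OF that, of k] 1 by linarith
      then have "{\<omega> \<in> space M. \<sigma> k \<omega> < s} = {}" by blast
      then show ?thesis by (simp only: sets.empty_sets)
    next
      case 2
      note measurable_occupation[OF prog H_borel less_imp_le[OF 2(1)], measurable]
      have "{\<omega> \<in> space M. \<sigma> k \<omega> < s} = {\<omega> \<in> space (?F s). ?occ s \<omega> \<noteq> 0}"
        using last_unvisited_less_iff[OF visits, of _ "real k" s] 2 by (auto simp: \<sigma>_def)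
      also have "\<dots> \<in> sets (?F s)" by measurable
      finally show ?thesis .
    next
      case 3
      have "\<sigma> k \<omega> < s" if "\<omega> \<in> space M" for \<omega>
        using \<sigma>(2)[OF that, of k] 3 by linarith
      then have "{\<omega> \<in> space M. \<sigma> k \<omega> < s} = space (?F s)" by auto
      then show ?thesis by (simp only: sets.top)
    qed
  qed
  have \<rho>_less: "{\<omega> \<in> space M. \<rho> k \<omega> < s} \<in> sets (?F s)" for k s
  proof -
    have "{\<omega> \<in> space M. \<rho> k \<omega> < s} = {\<omega> \<in> space M. \<sigma> k \<omega> < s} \<union> ({\<omega> \<in> space M. Tu k \<omega> < s} \<union> {\<omega> \<in> space M. Tv k \<omega> < s})"
      by (auto simp: \<rho>_def min_less_iff_disj)
    then show ?thesis using \<sigma>_less stopping_less[OF Tu(1)] stopping_less[OF Tv(1)] by auto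
  qed
  have \<rho>_meas [measurable]: "\<rho> k \<in> borel_measurable (P x)" for k
  proof (rule borel_measurableI_less)
    show "{\<omega> \<in> space (P x). \<rho> k \<omega> < s} \<in> sets (P x)" for s
      using \<rho>_less[of k s] F_P[of s] by (auto simp: space_P)
  qed
  \<comment> \<open>Evaluation at a random time is measurable by progressive measurability up to
    time \<open>k\<close>; the clamp has no effect, as \<open>\<rho> k\<close> lies between
    \<open>0\<close> and \<open>k\<close>.\<close>
  have X\<rho> [measurable]: "(\<lambda>\<omega>. X (\<rho> k \<omega>) \<omega>) \<in> borel_measurable (P x)" for k
  proof -
    have "(\<lambda>\<omega>. (\<omega>, \<rho> k \<omega>)) \<in> P x \<rightarrow>\<^sub>M ?F (real k) \<Otimes>\<^sub>M borel"
      using measurable_from_subalg[OF subalgebra_natural_filtration measurable_ident_sets[OF refl], of x "real k"]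
      by (intro measurable_Pair) auto
    from measurable_compose[OF this progressively_measurable_clamp[OF prog, of "real k"]]
    have "(\<lambda>\<omega>. X (max 0 (min (\<rho> k \<omega>) (real k))) \<omega>) \<in> borel_measurable (P x)" by simp
    then show ?thesis
      by (rule measurable_cong[THEN iffD1, rotated]) (use \<rho> in \<open>simp add: space_P min_absorb1 max_absorb2\<close>)
  qed
  have [measurable]: "u \<in> borel_measurable borel" "v \<in> borel_measurable borel"
    using u(1) v(1) by (auto simp: generator_pair_def)
  note H_borel [measurable]
  define B where "B k = {\<omega> \<in> space (P x). X (\<rho> k \<omega>) \<omega> \<notin> H}" for k
  have B [measurable]: "B k \<in> sets (P x)" for k unfolding B_def by measurable
  define Z where "Z n = {\<omega> \<in> space M. ?occ (real n * (r + 1)) \<omega> = 0}" for n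
  have Z [measurable]: "Z n \<in> sets (P x)" for n
  proof -
    have nn: "0 \<le> real n * (r + 1)" using r by simp
    note measurable_occupation[OF prog H_borel nn, measurable]
    have "{\<omega> \<in> space (?F (real n * (r + 1))). ?occ (real n * (r + 1)) \<omega> = 0} \<in> sets (?F (real n * (r + 1)))"
      by measurable
    then show ?thesis using F_P by (auto simp: Z_def)
  qed
  have Z_le: "prob (Z n) \<le> (1 - c) ^ n" for n
    unfolding Z_def using r c by (intro unvisited_measure_decay prog H_borel) auto
  have bound: "u x \<le> h + e * v x + (r + 1) / c + C * prob (B k)" for k
  proof -
    obtain Wu where Wu: "integrable (P x) Wu" "(\<integral>\<omega>. Wu \<omega> \<partial>P x) = 0"
      "AE \<omega> in P x. u (X (\<rho> k \<omega>) \<omega>) - u x - (LINT s:{0..\<rho> k \<omega>}|lborel. Lu (X s \<omega>)) = Wu \<omega>"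
      using Tu_stop[THEN spec, of k, THEN spec, of "real k", THEN spec, of "\<rho> k"] \<rho> \<rho>_less by auto
    obtain Wv where Wv: "integrable (P x) Wv" "(\<integral>\<omega>. Wv \<omega> \<partial>P x) = 0"
      "AE \<omega> in P x. v (X (\<rho> k \<omega>) \<omega>) - v x - (LINT s:{0..\<rho> k \<omega>}|lborel. Lv (X s \<omega>)) = Wv \<omega>"
      using Tv_stop[THEN spec, of k, THEN spec, of "real k", THEN spec, of "\<rho> k"] \<rho> \<rho>_less by auto
    \<comment> \<open>Zero occupation up to \<open>\<rho> k\<close> puts almost every earlier time
      off \<open>H\<close>, where the drift bounds on \<open>Lu\<close> and \<open>Lv\<close> hold;
      the null set of exceptions does not affect the time integrals.\<close>
    have unvisited: "AE s in lborel. s \<in> {0..\<rho> k \<omega>} \<longrightarrow> X s \<omega> \<notin> H" if "\<omega> \<in> space M" for \<omega>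
      using that by (intro AE_not_visited visits occ_\<rho>[of _ _ k]) auto
    have v_le: "AE \<omega> in P x. v (X (\<rho> k \<omega>) \<omega>) \<le> Wv \<omega> + v x"
      using Wv(3) AE_space
    proof eventually_elim
      case (elim \<omega>)
      have "0 \<le> (\<integral>s. - (indicator {0..\<rho> k \<omega>} s *\<^sub>R Lv (X s \<omega>)) \<partial>lborel)"
        using unvisited[of \<omega>] elim(2) v(3)
        by (intro integral_nonneg_AE) (auto elim!: eventually_mono simp: space_P indicator_def)
      then have "(LINT s:{0..\<rho> k \<omega>}|lborel. Lv (X s \<omega>)) \<le> 0"
        by (simp add: set_lebesgue_integral_def)
      with elim(1) show ?case by simp
    qed
    \<comment> \<open>As \<open>v\<close> is nonnegative, the upper bound \<open>v_le\<close>
      already dominates its absolute value.\<close>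
    have v_int: "integrable (P x) (\<lambda>\<omega>. v (X (\<rho> k \<omega>) \<omega>))"
    proof (rule Bochner_Integration.integrable_bound)
      show "integrable (P x) (\<lambda>\<omega>. Wv \<omega> + v x)" using Wv by simp
      show "AE \<omega> in P x. norm (v (X (\<rho> k \<omega>) \<omega>)) \<le> norm (Wv \<omega> + v x)"
        using v_le by eventually_elim (use v(2) in auto)
    qed simp
    have v_exp: "(\<integral>\<omega>. v (X (\<rho> k \<omega>) \<omega>) \<partial>P x) \<le> v x"
      using integral_mono_AE[OF v_int _ v_le] Wv by (simp add: prob_space)
    have u_ge: "AE \<omega> in P x. Wu \<omega> \<le> u (X (\<rho> k \<omega>) \<omega>) - u x + \<rho> k \<omega>"
    proof -
      have "AE \<omega> in P x. \<forall>t\<ge>0. set_integrable lborel {0..t} (\<lambda>s. Lu (X s \<omega>))"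
        using u(1) by (auto simp: generator_pair_def)
      then show ?thesis using Wu(3) AE_space
      proof eventually_elim
        case (elim \<omega>)
        then have \<omega>: "\<omega> \<in> space M" by (simp add: space_P)
        have "(\<integral>s. indicator {0..\<rho> k \<omega>} s *\<^sub>R (- 1) \<partial>lborel) \<le> (\<integral>s. indicator {0..\<rho> k \<omega>} s *\<^sub>R Lu (X s \<omega>) \<partial>lborel)"
        proof (rule integral_mono_AE)
          show "integrable lborel (\<lambda>s. indicator {0..\<rho> k \<omega>} s *\<^sub>R Lu (X s \<omega>))"
            using elim(1) \<rho>(1)[OF \<omega>] by (auto simp: set_integrable_def)
          show "integrable lborel (\<lambda>s. indicator {0..\<rho> k \<omega>} s *\<^sub>R (- 1 :: real))"
            using \<rho>(1)[OF \<omega>] by (simp add: integrable_indicator_iff)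
          show "AE s in lborel. indicator {0..\<rho> k \<omega>} s *\<^sub>R (- 1) \<le> indicator {0..\<rho> k \<omega>} s *\<^sub>R Lu (X s \<omega>)"
            using unvisited[OF \<omega>] u(3) by (auto elim!: eventually_mono simp: indicator_def)
        qed
        then have "- \<rho> k \<omega> \<le> (LINT s:{0..\<rho> k \<omega>}|lborel. Lu (X s \<omega>))"
          using \<rho>(1)[OF \<omega>] by (simp add: set_lebesgue_integral_def)
        with elim(2) show ?case by simp
      qed
    qed
    have u_le: "u (X (\<rho> k \<omega>) \<omega>) \<le> h + e * v (X (\<rho> k \<omega>) \<omega>) + C * indicator (B k) \<omega>" if "\<omega> \<in> space M" for \<omega>
    proof (cases "X (\<rho> k \<omega>) \<omega> \<in> H")
      case True
      then have "u (X (\<rho> k \<omega>) \<omega>) \<le> h + 0 + 0" using h by simp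
      also have "\<dots> \<le> h + e * v (X (\<rho> k \<omega>) \<omega>) + C * indicator (B k) \<omega>"
        using e v(2) by (intro add_mono mult_nonneg_nonneg) auto
      finally show ?thesis .
    next
      case False
      then show ?thesis using that e(3)[of "X (\<rho> k \<omega>) \<omega>"] h(1) by (simp add: B_def space_P)
    qed
    \<comment> \<open>\<open>m\<close> is the number of blocks begun by time
      \<open>\<rho> k\<close>, including the one starting at \<open>0\<close>. Each begins with zero
      occupation so far, so \<open>\<omega>\<close> lies in its \<open>Z n\<close>. Since
      \<open>\<rho> k \<le> k\<close> and blocks have length at least \<open>1\<close>,
      \<open>k + 1\<close> terms are enough.\<close>
    have \<rho>_le: "\<rho> k \<omega> \<le> (\<Sum>n<k + 1. (r + 1) * indicator (Z n) \<omega>)" if \<omega>: "\<omega> \<in> space M" for \<omega>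
    proof -
      define m where "m = nat \<lfloor>\<rho> k \<omega> / (r + 1)\<rfloor> + 1"
      have q: "0 \<le> \<rho> k \<omega> / (r + 1)" using \<rho>(1)[OF \<omega>] r by simp
      have "\<rho> k \<omega> / (r + 1) \<le> \<rho> k \<omega> / 1" using \<rho>(1)[OF \<omega>] r by (intro divide_left_mono) auto
      then have "\<rho> k \<omega> / (r + 1) \<le> real k" using \<rho>(2)[OF \<omega>, of k] by simp
      then have mk: "m \<le> k + 1" unfolding m_def by linarith
      have "\<rho> k \<omega> / (r + 1) \<le> real m" unfolding m_def using q by linarith
      then have "\<rho> k \<omega> \<le> real m * (r + 1)" using r by (simp add: pos_divide_le_eq)
      also have "\<dots> = (\<Sum>n<m. (r + 1) * indicator (Z n) \<omega>)"
      proof -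
        have "\<omega> \<in> Z n" if "n < m" for n
        proof -
          have "real n \<le> \<rho> k \<omega> / (r + 1)" using that q unfolding m_def by linarith
          then have "real n * (r + 1) \<le> \<rho> k \<omega>" using r by (simp add: pos_le_divide_eq)
          then show ?thesis using occ_\<rho>[OF \<omega>] \<omega> by (auto simp: Z_def)
        qed
        then show ?thesis by simp
      qed
      also have "\<dots> \<le> (\<Sum>n<k + 1. (r + 1) * indicator (Z n) \<omega>)"
        using mk r by (intro sum_mono2) auto
      finally show ?thesis .
    qed
    have ind: "integrable (P x) (indicator A :: 'w \<Rightarrow> real)" if "A \<in> sets (P x)" for A
      using that by (intro integrable_real_indicator) (auto simp: emeasure_eq_measure)
    define S where "S \<omega> = (\<Sum>n<k + 1. (r + 1) * indicator (Z n) \<omega>)" for \<omega>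
    have S_int: "integrable (P x) S"
      unfolding S_def by (intro Bochner_Integration.integrable_sum integrable_mult_right ind Z)
    have S_exp: "(\<integral>\<omega>. S \<omega> \<partial>P x) = (\<Sum>n<k + 1. (r + 1) * prob (Z n))"
      unfolding S_def
      by (subst Bochner_Integration.integral_sum) (intro integrable_mult_right ind Z, intro sum.cong refl, simp)
    \<comment> \<open>Integrating this removes \<open>Wu\<close>, whose mean is \<open>0\<close>,
      and leaves a bound for \<open>u x\<close>.\<close>
    have "AE \<omega> in P x. Wu \<omega> \<le> ((h - u x) + e * v (X (\<rho> k \<omega>) \<omega>)) +
        (C * indicator (B k) \<omega> + S \<omega>)"
      using u_ge AE_space
    proof eventually_elim
      case (elim \<omega>)
      then have "\<omega> \<in> space M" by (simp add: space_P)
      from elim(1) u_le[OF this] \<rho>_le[OF this] show ?case unfolding S_def by linarith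
    qed
    then have "(\<integral>\<omega>. Wu \<omega> \<partial>P x) \<le> (\<integral>\<omega>. ((h - u x) + e * v (X (\<rho> k \<omega>) \<omega>)) +
        (C * indicator (B k) \<omega> + S \<omega>) \<partial>P x)"
      using Wu(1) v_int S_int ind[OF B]
      by (intro integral_mono_AE Bochner_Integration.integrable_add integrable_mult_right) auto
    also have "\<dots> = ((h - u x) + e * (\<integral>\<omega>. v (X (\<rho> k \<omega>) \<omega>) \<partial>P x)) +
        (C * prob (B k) + (\<Sum>n<k + 1. (r + 1) * prob (Z n)))"
      unfolding S_exp[symmetric] using v_int S_int ind[OF B] by (simp add: prob_space)
    also have "\<dots> \<le> ((h - u x) + e * v x) + (C * prob (B k) + (r + 1) / c)"
    proof -
      have "(\<Sum>n<k + 1. (r + 1) * prob (Z n)) \<le> (\<Sum>n<k + 1. (r + 1) * (1 - c) ^ n)"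
        using Z_le r by (intro sum_mono mult_left_mono) auto
      also have "\<dots> = (r + 1) * ((1 - (1 - c) ^ (k + 1)) / c)"
        using c(1) by (subst sum_distrib_left[symmetric], subst sum_gp_strict) auto
      also have "\<dots> \<le> (r + 1) * (1 / c)"
        using c(1) c1 r by (intro mult_left_mono divide_right_mono) auto
      finally have "(\<Sum>n<k + 1. (r + 1) * prob (Z n)) \<le> (r + 1) / c" by simp
      moreover have "e * (\<integral>\<omega>. v (X (\<rho> k \<omega>) \<omega>) \<partial>P x) \<le> e * v x"
        using v_exp e(1) by (rule mult_left_mono)
      ultimately show ?thesis by linarith
    qed
    finally show ?thesis using Wu(2) by simp
  qed
  \<comment> \<open>Almost every path has positive occupation by some time
    \<open>s = n * (r + 1)\<close>. Once \<open>k\<close> and both localizing times exceed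
    \<open>s\<close>, the time \<open>\<rho> k\<close> equals \<open>\<sigma> k < k\<close>, so the
    stopped path is in the closed set \<open>H\<close>.\<close>
  have "(\<lambda>k. prob (B k)) \<longlonglongrightarrow> 0"
  proof -
    have visited: "AE \<omega> in P x. \<exists>n. \<omega> \<notin> Z n"
    proof (rule AE_I[of _ _ "\<Inter>n. Z n"])
      have "prob (\<Inter>n. Z n) \<le> (1 - c) ^ n" for n
        using finite_measure_mono[of "\<Inter>n. Z n" "Z n"] Z_le[of n] Z by (auto intro: order_trans)
      moreover have "(\<lambda>n. (1 - c) ^ n) \<longlonglongrightarrow> 0"
        using c(1) c1 by (intro LIMSEQ_realpow_zero) auto
      ultimately have "prob (\<Inter>n. Z n) \<le> 0"
        by (intro LIMSEQ_le_const) auto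
      then show "emeasure (P x) (\<Inter>n. Z n) = 0"
        by (simp add: emeasure_eq_measure measure_le_0_iff)
    qed auto
    have "(\<lambda>k. \<integral>\<omega>. indicator (B k) \<omega> \<partial>P x) \<longlonglongrightarrow> (\<integral>\<omega>. (0::real) \<partial>P x)"
    proof (rule integral_dominated_convergence[where w="\<lambda>_. 1"])
      show "AE \<omega> in P x. (\<lambda>k. indicator (B k) \<omega> :: real) \<longlonglongrightarrow> 0"
        using visited Tu(3) Tv(3) AE_space
      proof eventually_elim
        case (elim \<omega>)
        then obtain n where n: "\<omega> \<notin> Z n" by blast
        have \<omega>: "\<omega> \<in> space M" using elim by (simp add: space_P)
        define s where "s = real n * (r + 1)"
        have s: "0 \<le> s" using r by (simp add: s_def)
        have "\<forall>\<^sub>F k in sequentially. s < Tu k \<omega>" "\<forall>\<^sub>F k in sequentially. s < Tv k \<omega>"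
          using elim by (auto simp: filterlim_at_top_dense)
        moreover have "\<forall>\<^sub>F k in sequentially. s < real k"
          using filterlim_real_sequentially by (auto simp: filterlim_at_top_dense)
        ultimately have "\<forall>\<^sub>F k in sequentially. indicator (B k) \<omega> = (0::real)"
        proof eventually_elim
          case (elim k)
          have "\<sigma> k \<omega> < s"
            using last_unvisited_less_iff[OF visits[OF \<omega>], of "real k" s] n \<omega> s elim
            by (auto simp: \<sigma>_def Z_def s_def)
          then have "\<rho> k \<omega> = \<sigma> k \<omega>" "\<sigma> k \<omega> < real k" using elim by (auto simp: \<rho>_def)
          then have "X (\<rho> k \<omega>) \<omega> \<in> H"
            using last_unvisited_mem[OF visits[OF \<omega>], of "real k"] rc[OF \<omega>] H by (simp add: \<sigma>_def)
          then show ?case by (simp add: B_def)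
        qed
        then show ?case by (rule tendsto_eventually)
      qed
    qed auto
    then show ?thesis by simp
  qed
  then have "(\<lambda>k. h + e * v x + (r + 1) / c + C * prob (B k)) \<longlonglongrightarrow> h + e * v x + (r + 1) / c + C * 0"
    by (intro tendsto_intros)
  then show ?thesis using bound by (intro LIMSEQ_le_const) auto
qed

section \<open>Strong ergodicity\<close>

lemma abs_diff_measure_le_tv_dist:
  assumes "prob_space \<mu>" "prob_space \<nu>" "A \<in> sets borel"
  shows "\<bar>measure \<mu> A - measure \<nu> A\<bar> \<le> tv_dist \<mu> \<nu>"
  unfolding tv_dist_def
proof (rule cSUP_upper[OF assms(3)])
  have "\<bar>measure \<mu> B - measure \<nu> B\<bar> \<le> 1" for B
    using prob_space.prob_le_1[OF assms(1), of B] prob_space.prob_le_1[OF assms(2), of B]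
      measure_nonneg[of \<mu> B] measure_nonneg[of \<nu> B] by linarith
  then show "bdd_above ((\<lambda>B. \<bar>measure \<mu> B - measure \<nu> B\<bar>) ` sets borel)"
    by (intro bdd_aboveI2[of _ _ 1]) auto
qed

text \<open>By uniqueness the limit law in strong ergodicity is \<open>\<pi>\<close>. After time
  \<open>r\<close> the total variation distance is at most half of \<open>measure \<pi> H\<close>,
  which leaves the other half as a lower bound from every starting point.\<close>

lemma (in markov_process) strongly_ergodic_visit_prob:
  assumes "strongly_ergodic K" "ergodic K \<pi>" "H \<in> sets borel" "0 < measure \<pi> H"
  obtains r c where "0 \<le> r" "0 < c" "\<And>y t. r \<le> t \<Longrightarrow> c \<le> measure (K t y) H"
proof -
  obtain \<epsilon> C \<nu> where \<epsilon>: "0 < \<epsilon>" "0 < C" and \<nu>: "invariant_measure K \<nu>" "prob_space \<nu>"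
    and tv: "\<And>t x. 0 \<le> t \<Longrightarrow> tv_dist (K t x) \<nu> \<le> C * exp (- \<epsilon> * t)"
    using assms(1) unfolding strongly_ergodic_def by blast
  have "\<nu> = \<pi>" using assms(2) \<nu> unfolding ergodic_def by blast
  define c where "c = measure \<pi> H / 2"
  have "0 < c" using assms(4) by (simp add: c_def)
  \<comment> \<open>\<open>r0\<close> solves \<open>C * exp (- \<epsilon> * r0) = c\<close>. It is
    negative if \<open>C < c\<close>, hence the maximum with \<open>0\<close> below.\<close>
  define r0 where "r0 = ln (C / c) / \<epsilon>"
  have r0: "C * exp (- \<epsilon> * t) \<le> c" if "r0 \<le> t" for t
  proof -
    have "ln (C / c) \<le> \<epsilon> * t"
      using that \<epsilon>(1) by (simp add: r0_def pos_divide_le_eq mult.commute)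
    then have "C / c \<le> exp (\<epsilon> * t)"
      using \<epsilon>(2) \<open>0 < c\<close> by (subst (asm) exp_le_cancel_iff[symmetric]) simp
    then show ?thesis
      using \<open>0 < c\<close> by (simp add: exp_minus field_simps)
  qed
  show thesis
  proof (rule that[of "max 0 r0" c])
    fix y t assume t: "max 0 r0 \<le> t"
    have "prob_space (K t y)" using t by (intro prob_space_K) simp
    from abs_diff_measure_le_tv_dist[OF this \<nu>(2) assms(3)]
    have "\<bar>measure (K t y) H - measure \<pi> H\<bar> \<le> C * exp (- \<epsilon> * t)"
      using tv[of t y] t \<open>\<nu> = \<pi>\<close> by auto
    with r0[of t] t show "c \<le> measure (K t y) H" by (simp add: c_def abs_le_iff)
  qed (use assms(4) in \<open>auto simp: c_def\<close>)
qed

theorem theorem1: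
  fixes M :: "'w measure"
    and P :: "'a::polish_space \<Rightarrow> 'w measure"
    and X :: "real \<Rightarrow> 'w \<Rightarrow> 'a"
    and K :: "real \<Rightarrow> 'a \<Rightarrow> 'a measure"
    and L :: "('a \<Rightarrow> real) \<Rightarrow> 'a \<Rightarrow> real"
    and \<pi> :: "'a measure"
    and E :: "nat \<Rightarrow> 'a set"
    and H :: "'a set"
    and u v :: "'a \<Rightarrow> real"
    and d :: real
  assumes markov: "markov_process M P X K"
    and right_cont: "\<And>\<omega>. \<omega> \<in> space M \<Longrightarrow> right_continuous_path (\<lambda>t. X t \<omega>)"
    and progressive: "progressively_measurable (natural_filtration M X) X"
    and generator: "extended_generator M P X L"
    and non_explosive: "non_explosive P X E"
    and ergodic: "ergodic K \<pi>"
    and E_open: "\<And>n. open (E n)"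
    and E_bounded: "\<And>n. bounded (E n)"
    and E_incseq: "incseq E"
    and E_Union: "(\<Union>n. E n) = UNIV"
    and H: "closed H" "H \<subseteq> E 1" "measure \<pi> H > 0"
    and u: "u \<in> extended_domain M P X" "norm_like u"
    and v: "v \<in> extended_domain M P X" "norm_like v"
    and a: "\<And>x. x \<notin> H \<Longrightarrow> L u x \<ge> - 1" "locally_bounded u"
    and b: "d > 0" "\<And>x. L v x \<le> d * indicator H x"
    and c: "(\<lambda>n. SUP x\<in>- E n. ereal (u x / v x)) \<longlonglongrightarrow> 0"
  shows "\<not> strongly_ergodic K"
proof
  assume se: "strongly_ergodic K"
  interpret markov_process M P X K by (rule markov)
  have H_borel: "H \<in> sets borel" using H(1) by auto
  obtain r c where rc: "0 \<le> r" "0 < c" "\<And>y t. r \<le> t \<Longrightarrow> c \<le> measure (K t y) H"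
    using strongly_ergodic_visit_prob[OF se ergodic H_borel H(3)] by blast
  have gen: "generator_pair M P X u (L u)" "generator_pair M P X v (L v)"
    using generator u(1) v(1) by (auto simp: extended_generator_def)
  have nonneg: "0 \<le> u y" "0 \<le> v y" for y
    using u(2) v(2) by (auto simp: norm_like_def)
  have bounded_above: "\<exists>b\<ge>0. \<forall>y\<in>B. u y \<le> b" if B: "bounded B" for B
  proof -
    have "bounded (u ` B)" using a(2) B by (simp add: locally_bounded_def)
    then obtain b where b: "\<And>y. y \<in> B \<Longrightarrow> norm (u y) \<le> b" unfolding bounded_iff by auto
    have "u y \<le> max 0 b" if "y \<in> B" for y
      using b[OF that] by (simp add: abs_le_iff le_max_iff_disj)
    then show ?thesis by (intro exI[of _ "max 0 b"]) auto
  qed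
  obtain h where h: "0 \<le> h" "\<And>y. y \<in> H \<Longrightarrow> u y \<le> h"
    using bounded_above[OF bounded_subset[OF E_bounded H(2)]] by blast
  have "u x \<le> h + (r + 1) / c" for x
  proof -
    have eps: "u x \<le> h + e * v x + (r + 1) / c" if "0 < e" for e
    proof -
      have "\<forall>\<^sub>F n in sequentially. (SUP y\<in>- E n. ereal (u y / v y)) < ereal e"
        using c \<open>0 < e\<close> by (intro order_tendstoD(2)) auto
      then obtain n where n: "(SUP y\<in>- E n. ereal (u y / v y)) < ereal e"
        using eventually_happens'[OF sequentially_bot] by blast
      \<comment> \<open>Where \<open>v y = 0\<close> the quotient \<open>u y / v y\<close> is
        \<open>0\<close> by convention and says nothing about \<open>u\<close>; off
        \<open>{y. v y \<le> 1}\<close> it can be multiplied out. This sublevel set is bounded,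
        since its closure is compact, so together with \<open>E n\<close> it is absorbed into
        \<open>C\<close>.\<close>
      have "compact (closure {y. v y \<le> 1})" using v(2) by (simp add: norm_like_def)
      then have "bounded {y. v y \<le> 1}"
        using compact_imp_bounded bounded_subset closure_subset by metis
      then obtain C where C: "0 \<le> C" "\<And>y. y \<in> E n \<union> {y. v y \<le> 1} \<Longrightarrow> u y \<le> C"
        using bounded_above[of "E n \<union> {y. v y \<le> 1}"] E_bounded[of n] by auto
      have "u y \<le> e * v y + C" for y
      proof (cases "y \<in> E n \<union> {y. v y \<le> 1}")
        case True
        have "0 \<le> e * v y" using \<open>0 < e\<close> nonneg(2) by simp
        with C(2)[OF True] show ?thesis by linarith
      next
        case False
        then have "ereal (u y / v y) \<le> (SUP y\<in>- E n. ereal (u y / v y))" by (intro SUP_upper) auto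
        also note n
        finally have "u y / v y < e" by simp
        with False have "u y < e * v y" by (simp add: pos_divide_less_eq)
        with C(1) show ?thesis by simp
      qed
      moreover have "L v y \<le> 0" if "y \<notin> H" for y using b(2)[of y] that by simp
      ultimately show ?thesis
        using \<open>0 < e\<close> C(1)
        by (intro lyapunov_bound[OF progressive right_cont H(1) rc gen(1) nonneg(1) a(1) gen(2) nonneg(2) _ h]) auto
    qed
    show ?thesis
    proof (rule field_le_epsilon)
      fix \<delta> :: real assume "0 < \<delta>"
      \<comment> \<open>The summand \<open>1\<close> avoids a division by zero when
        \<open>v x = 0\<close> and still gives \<open>e * v x \<le> \<delta>\<close>.\<close>
      define e where "e = \<delta> / (v x + 1)"
      have "0 < e" using \<open>0 < \<delta>\<close> nonneg(2)[of x] by (simp add: e_def)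
      moreover have "e * v x \<le> \<delta>"
        using \<open>0 < \<delta>\<close> nonneg(2)[of x] by (simp add: e_def field_simps)
      ultimately show "u x \<le> h + (r + 1) / c + \<delta>" using eps[of e] by linarith
    qed
  qed
  then have "{x. u x \<le> h + (r + 1) / c} = UNIV" by auto
  \<comment> \<open>\<open>norm_like\<close> grants compactness at positive levels only.\<close>
  moreover have "0 < h + (r + 1) / c" using h(1) rc by (intro add_nonneg_pos divide_pos_pos) auto
  ultimately have "compact (UNIV :: 'a set)"
    using u(2) unfolding norm_like_def by (metis closure_UNIV)
  then obtain I where I: "finite I" "UNIV \<subseteq> (\<Union>n\<in>I. E n)"
    using compactE_image[of UNIV UNIV E] E_open E_Union by auto
  \<comment> \<open>As \<open>E\<close> is increasing, the finite subcover is contained in every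
    \<open>E n\<close> with \<open>n\<close> at least the largest index used.\<close>
  obtain N where N: "\<And>i. i \<in> I \<Longrightarrow> i \<le> N" using I(1) by (meson finite_nat_set_iff_bounded_le)
  have "E n = UNIV" if "N \<le> n" for n
    using I(2) N that incseqD[OF E_incseq] by (meson UN_least order_trans top.extremum_uniqueI)
  then have "\<forall>\<^sub>F n in sequentially. (SUP x\<in>- E n. ereal (u x / v x)) = - \<infinity>"
    by (intro eventually_sequentiallyI[of N]) (simp add: bot_ereal_def)
  then have "(\<lambda>n. SUP x\<in>- E n. ereal (u x / v x)) \<longlonglongrightarrow> - \<infinity>"
    by (rule tendsto_eventually)
  with c have "(0::ereal) = - \<infinity>" by (rule LIMSEQ_unique)
  then show False by simp
qed

end
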